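(* Let $L\in\mathbb{F}_q[T]$, $L\ne T$, be a prime of degree $d$. Supersingular Drinfeld modules in characteristic $L$ of type $$\phi_T=u\tau^2+(u+\alpha)\tau+\alpha,\qquad u\neq 0,$$ where $\alpha\in\mathbb{F}_L$ is the class of $T$, are in one-to-one correspondence with the supersingular points of $X_0(T)/\mathbb{F}_L$. Moreover, they correspond (via $a=-u/\alpha^q$) to the values $a\in\mathbb{F}_L^{(2)}$ satisfying $p_d^{(L)}(a)=0$. In particular, all roots of $p_d^{(L)}(s)$ are in $\mathbb{F}_L^{(2)}$.
   Context: $\mathbb{F}_q$ is a finite field, $\mathbb{F}=\mathbb{F}_q(T)$; a prime of $\mathbb{F}_q[T]$ means a monic irreducible polynomial; $\mathbb{F}_L=\mathbb{F}_q[T]/(L)$ and $\mathbb{F}_L^{(2)}$ is its quadratic extension. Polynomials: $p_{-1}(s)=0$, $p_0(s)=1$ and for $i\ge 0$ $$p_{i+1}(s)=(s^{q^i}-1)p_i(s)+\frac{T^{q^i-1}-1}{T^{q^i-1}}s^{q^i}p_{i-1}(s)\in\mathbb{F}[s];$$ $p_i^{(L)}(s)\in\mathbb{F}_L[s]$ is the reduction of $p_i(s)$ modulo $L$ (coefficients lie in $\mathbb{F}_q[T,1/T]$, so this makes sense for $L\neq T$). Drinfeld modules: $\tau$ is the $q$-Frobenius. Drinfeld modules of the given type are considered over the algebraic closure $\overline{\mathbb{F}}_L$, as rank two Drinfeld $\mathbb{F}_q[T]$-modules of characteristic $L$, with parameter $u\in\overline{\mathbb{F}}_L\setminus\{0\}$.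 Such $\phi$ is supersingular if $\phi$ has no nonzero $L$-torsion points over $\overline{\mathbb{F}}_L$, i.e. $\phi_L$ is purely inseparable. The $j$-invariant of $\phi_T=\Delta\tau^2+g\tau+\alpha$ is $g^{q+1}/\Delta$. Curve: $X_0(T)/\mathbb{F}_L$ is the reduction modulo $L$ of the Drinfeld modular curve $X_0(T)$; it is rational with uniformizer $u$, and its projection to the $j$-line $X(1)/\mathbb{F}_L$ is $j=(u+\alpha)^{q+1}/u$. Supersingular points of $X_0(T)/\mathbb{F}_L$ are the (geometric) points lying above supersingular points of $X(1)/\mathbb{F}_L$ (the $j$-invariants of supersingular Drinfeld modules). *)

theory Defs
  imports
    "HOL-Algebra.Embedded_Algebras"
    "HOL-Algebra.Algebraic_Closure_Type"
    "HOL-Computational_Algebra.Polynomial"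
    "HOL-Computational_Algebra.Fraction_Field"
    "HOL-Library.Cardinality"
begin

text \<open>The variable \<open>T\<close> of \<open>F\<^sub>q[T]\<close>; throughout, \<open>F\<^sub>q\<close> is a type \<open>'f\<close> and \<open>q = CARD('f)\<close>.\<close>

abbreviation T_poly :: "'f::field poly" where
  "T_poly \<equiv> [:0, 1:]"

text \<open>
  \<open>F\<^sub>q[T]/(L)\<close> depends on the term \<open>L\<close>, so it is given as a field \<open>'l\<close> together with the
  reduction map, a surjective ring homomorphism \<open>F\<^sub>q[T] \<rightarrow> 'l\<close> with kernel \<open>(L)\<close>.
\<close>

definition residue_map :: "'f::field poly \<Rightarrow> ('f poly \<Rightarrow> 'l::field) \<Rightarrow> bool" where
  "residue_map L \<rho> \<longleftrightarrow>
     \<rho> 1 = 1 \<and> (\<forall>a b. \<rho> (a + b) = \<rho> a + \<rho> b) \<and> (\<forall>a b. \<rho> (a * b) = \<rho> a * \<rho> b) \<and>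
     surj \<rho> \<and> (\<forall>a. \<rho> a = 0 \<longleftrightarrow> L dvd a)"

text \<open>
  Reduction of a rational function whose denominator can be chosen prime to \<open>L\<close>
  (unspecified for other rational functions).
\<close>

definition fract_red :: "('f::field poly \<Rightarrow> 'l::field) \<Rightarrow> 'f poly fract \<Rightarrow> 'l" where
  "fract_red \<rho> x = (THE y. \<exists>a b. \<rho> b \<noteq> 0 \<and> x = Fract a b \<and> y = \<rho> a / \<rho> b)"


subsection \<open>The polynomials \<open>p\<^sub>i\<close>\<close>

text \<open>The index is shifted by one: \<open>p_shift i\<close> is \<open>p\<^bsub>i-1\<^esub>\<close>, starting with \<open>p\<^bsub>-1\<^esub> = 0\<close>.\<close>

fun p_shift :: "nat \<Rightarrow> 'f::{finite,field} poly fract poly" where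
  "p_shift 0 = 0"
| "p_shift (Suc 0) = 1"
| "p_shift (Suc (Suc i)) =
     (let q = CARD('f); T = Fract T_poly 1
      in (monom 1 (q ^ i) - 1) * p_shift (Suc i)
         + smult ((T ^ (q ^ i - 1) - 1) / T ^ (q ^ i - 1)) (monom 1 (q ^ i)) * p_shift i)"

definition p_poly :: "nat \<Rightarrow> 'f::{finite,field} poly fract poly" where
  "p_poly i = p_shift (Suc i)"

definition p_red :: "('f::{finite,field} poly \<Rightarrow> 'l::field) \<Rightarrow> nat \<Rightarrow> 'l poly" where
  "p_red \<rho> i = map_poly (fract_red \<rho>) (p_poly i)"


subsection \<open>Drinfeld modules\<close>

text \<open>
  An element \<open>\<Sum>i. c\<^sub>i \<tau>\<^sup>i\<close> of the twisted polynomial ring \<open>K{\<tau>}\<close>, in which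
  \<open>\<tau> c = c\<^sup>q \<tau>\<close>, is encoded by the polynomial with the same coefficients; addition is the
  polynomial addition, but multiplication is \<open>tw_mult\<close>. \<open>\<tau>\<close> acts on \<open>K\<close> as \<open>x \<mapsto> x\<^sup>q\<close>.
\<close>

definition tw_mult :: "nat \<Rightarrow> 'k::field poly \<Rightarrow> 'k poly \<Rightarrow> 'k poly" where
  "tw_mult q f g =
     (\<Sum>i\<le>degree f. \<Sum>j\<le>degree g. monom (coeff f i * coeff g j ^ (q ^ i)) (i + j))"

definition tw_eval :: "nat \<Rightarrow> 'k::field poly \<Rightarrow> 'k \<Rightarrow> 'k" where
  "tw_eval q f x = (\<Sum>i\<le>degree f. coeff f i * x ^ (q ^ i))"

text \<open>
  Drinfeld \<open>F\<^sub>q[T]\<close>-modules of rank \<open>r\<close> over a field \<open>K\<close> with structure map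
  \<open>\<gamma> : F\<^sub>q[T] \<rightarrow> K\<close>: homomorphisms of \<open>F\<^sub>q\<close>-algebras \<open>\<phi> : F\<^sub>q[T] \<rightarrow> K{\<tau>}\<close> such that \<open>\<phi>\<^sub>a\<close> has
  constant term \<open>\<gamma>(a)\<close> and \<open>\<phi>\<^sub>T\<close> has degree \<open>r > 0\<close> in \<open>\<tau>\<close>. The characteristic is \<open>ker \<gamma>\<close>.
\<close>

definition drinfeld_module ::
  "('f::{finite,field} poly \<Rightarrow> 'k::field) \<Rightarrow> nat \<Rightarrow> ('f poly \<Rightarrow> 'k poly) \<Rightarrow> bool" where
  "drinfeld_module \<gamma> r \<phi> \<longleftrightarrow>
     (\<forall>a b. \<phi> (a + b) = \<phi> a + \<phi> b) \<and>
     (\<forall>a b. \<phi> (a * b) = tw_mult CARD('f) (\<phi> a) (\<phi> b)) \<and>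
     (\<forall>c. \<phi> [:c:] = [:\<gamma> [:c:]:]) \<and>
     (\<forall>a. coeff (\<phi> a) 0 = \<gamma> a) \<and>
     0 < r \<and> degree (\<phi> T_poly) = r"

text \<open>To be used with \<open>K\<close> algebraically closed and \<open>ker \<gamma> = (L)\<close>.\<close>

definition supersingular ::
  "'f::{finite,field} poly \<Rightarrow> ('f poly \<Rightarrow> 'k::field poly) \<Rightarrow> bool" where
  "supersingular L \<phi> \<longleftrightarrow> (\<forall>x. tw_eval CARD('f) (\<phi> L) x = 0 \<longrightarrow> x = 0)"

definition j_invariant :: "('f::{finite,field} poly \<Rightarrow> 'k::field poly) \<Rightarrow> 'k" where
  "j_invariant \<phi> = coeff (\<phi> T_poly) 1 ^ (CARD('f) + 1) / coeff (\<phi> T_poly) 2"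

definition supersingular_of_type ::
  "'f::{finite,field} poly \<Rightarrow> ('f poly \<Rightarrow> 'k::field) \<Rightarrow> ('f poly \<Rightarrow> 'k poly) set" where
  "supersingular_of_type L \<gamma> =
     {\<phi>. drinfeld_module \<gamma> 2 \<phi> \<and> supersingular L \<phi> \<and>
         (\<exists>u. u \<noteq> 0 \<and> \<phi> T_poly = [:\<gamma> T_poly, u + \<gamma> T_poly, u:])}"


subsection \<open>Modular curves\<close>

text \<open>
  Both \<open>X(1)\<close> (coordinate \<open>j\<close>) and \<open>X\<^sub>0(T)\<close> (coordinate \<open>u\<close>) are projective lines; these are
  their points over \<open>K\<close>. The points \<open>u = 0\<close> and \<open>u = \<infinity>\<close> of \<open>X\<^sub>0(T)\<close> are the two cusps.
\<close>

datatype 'k proj_line = Affine 'k | Infinity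

fun X0T_to_X1 :: "nat \<Rightarrow> 'k::field \<Rightarrow> 'k proj_line \<Rightarrow> 'k proj_line" where
  "X0T_to_X1 q \<alpha> (Affine u) =
     (if u = 0 then Infinity else Affine ((u + \<alpha>) ^ (q + 1) / u))"
| "X0T_to_X1 q \<alpha> Infinity = Infinity"

definition supersingular_X1 ::
  "'f::{finite,field} poly \<Rightarrow> ('f poly \<Rightarrow> 'k::field) \<Rightarrow> 'k proj_line set" where
  "supersingular_X1 L \<gamma> =
     {Affine (j_invariant \<phi>) | \<phi>. drinfeld_module \<gamma> 2 \<phi> \<and> supersingular L \<phi>}"

definition supersingular_X0T ::
  "'f::{finite,field} poly \<Rightarrow> ('f poly \<Rightarrow> 'k::field) \<Rightarrow> 'k proj_line set" where
  "supersingular_X0T L \<gamma> = {P. X0T_to_X1 CARD('f) (\<gamma> T_poly) P \<in> supersingular_X1 L \<gamma>}"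


subsection \<open>The quadratic extension\<close>

definition quadratic_extension :: "'l::field alg_closure set \<Rightarrow> bool" where
  "quadratic_extension E \<longleftrightarrow>
     subfield E ring_of_type_algebra \<and> range to_ac \<subseteq> E \<and>
     ring.dimension ring_of_type_algebra 2 (range (to_ac :: 'l \<Rightarrow> 'l alg_closure)) E"

end

theory Submission
  imports Defs
begin

text \<open>
  Let \<open>K\<close> be the algebraic closure of \<open>F\<^sub>L\<close>, \<open>\<gamma>\<close> the reduction map from \<open>F\<^sub>q[T]\<close> to \<open>K\<close>,
  and \<open>\<alpha> = \<gamma>(T)\<close>. Everything happens in the twisted polynomial ring \<open>K{\<tau>}\<close>, where
  \<open>\<phi>\<^sub>T = u \<tau>\<^sup>2 + (u + \<alpha>) \<tau> + \<alpha> = (u \<tau> + \<alpha>)(\<tau> + 1)\<close>.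

  Supersingularity is a condition on one coefficient. Let \<open>n\<close> be the lowest index with a nonzero
  coefficient in \<open>\<phi>\<^sub>L\<close>. Comparing lowest terms in \<open>\<phi>\<^sub>L \<phi>\<^sub>T = \<phi>\<^sub>T \<phi>\<^sub>L\<close> gives \<open>\<alpha>^(q^n) = \<alpha>\<close>, so \<open>d\<close>
  divides \<open>n\<close>. As \<open>\<phi>\<^sub>L\<close> has constant term \<open>0\<close> and degree \<open>2d\<close>, either \<open>n = d\<close> or \<open>n = 2d\<close>. Hence
  \<open>\<phi>\<close> is supersingular iff the coefficient of \<open>\<tau>^d\<close> in \<open>\<phi>\<^sub>L\<close> (the Hasse coefficient) vanishes, and
  then \<open>\<phi>\<^sub>L = c \<tau>^(2d)\<close> (lemmas \<open>supersingular_iff_hasse\<close> and \<open>hasse_zero_imp_monom\<close>).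

  The Hasse coefficient is \<open>p\<^sub>d(-u/\<alpha>^q)\<close> up to a nonzero factor (lemma \<open>hasse_iff_p_root\<close>). In
  generic characteristic the logarithm \<open>\<lambda>\<close> of a Drinfeld module satisfies \<open>\<lambda> \<phi>\<^sub>a = a \<lambda>\<close>, and its
  coefficients obey a three-term recursion in which that of \<open>\<tau>^i\<close> is obtained on division by
  \<open>\<alpha> - \<alpha>^(q^i)\<close>. In characteristic \<open>L\<close> the division is possible for \<open>i < d\<close> and fails at \<open>i = d\<close>.
  What survives is a polynomial \<open>\<mu>\<close> with constant term \<open>1\<close> and
  \<open>\<mu> \<phi>\<^sub>T = \<alpha> \<mu> + e \<tau>^d\<close> modulo \<open>\<tau>^(d+1)\<close>. Because \<open>\<alpha>^(q^d) = \<alpha>\<close>, the error term extends to all \<open>a\<close>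
  as a derivation: \<open>\<mu> \<phi>\<^sub>a = \<gamma>(a) \<mu> + e \<gamma>(a') \<tau>^d\<close>. At \<open>a = L\<close> this says that the Hasse
  coefficient is \<open>e \<gamma>(L')\<close>, and \<open>\<gamma>(L') \<noteq> 0\<close> because \<open>L\<close> is separable. The logarithm that produces
  exactly the recursion of the \<open>p\<^sub>i\<close> is the one of the isogenous module
  \<open>\<psi>\<^sub>T = (\<tau> + 1)(u \<tau> + \<alpha>)\<close>; multiplying it by \<open>\<tau> + 1\<close> from the right turns it into a \<open>\<mu>\<close> for \<open>\<phi>\<close>.

  The parameter \<open>u\<close> of a supersingular module lies in \<open>F\<^sub>L\<^sup>(\<^sup>2\<^sup>)\<close> (lemma
  \<open>supersingular_parameter_power\<close>). If \<open>x \<noteq> 0\<close> and \<open>x^q = -x\<close>, then \<open>\<tau> + 1\<close>, and with it \<open>\<phi>\<^sub>T\<close>,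
  kills \<open>x\<close>, so \<open>\<phi>\<^sub>L\<close> multiplies \<open>x\<close> by the constant term of \<open>L\<close>. On the other hand
  \<open>\<phi>\<^sub>L x = c x^(q^(2d)) = c x\<close>. Therefore \<open>c\<close> lies in \<open>F\<^sub>q\<close>, and the coefficients of \<open>\<tau>^(2d+2)\<close>
  in \<open>\<phi>\<^sub>L \<phi>\<^sub>T = \<phi>\<^sub>T \<phi>\<^sub>L\<close> give \<open>u^(q^(2d)) = u\<close>.

  Finally, a noncuspidal point \<open>u\<close> of \<open>X\<^sub>0(T)\<close> is supersingular iff its \<open>j\<close>-value
  \<open>(u + \<alpha>)^(q+1) / u\<close> is that of a supersingular \<open>\<psi>\<close>. Over \<open>K\<close>, equality of \<open>j\<close>-invariants
  yields \<open>c\<close> such that \<open>c\<^sup>-\<^sup>1 \<psi> c\<close> is the module of the given type with parameter \<open>u\<close> (lemma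
  \<open>supersingular_same_j\<close>).
\<close>

section \<open>Powers in finite fields\<close>

text \<open>
  For \<open>x \<noteq> 0\<close>, multiplication by \<open>x\<close> permutes the nonzero elements of \<open>S\<close>; compare their product
  with itself. Stated for a subset because it is used for \<open>F\<^sub>q\<close>, \<open>F\<^sub>L\<close> and \<open>F\<^sub>L\<^sup>(\<^sup>2\<^sup>)\<close>, of which
  the last two sit inside the algebraic closure.
\<close>

lemma power_card_eq_self:
  fixes S :: "'k::field set"
  assumes fin: "finite S" and zero: "0 \<in> S"
    and mult: "\<And>x y. x \<in> S \<Longrightarrow> y \<in> S \<Longrightarrow> x * y \<in> S" and x: "x \<in> S"
  shows "x ^ card S = x"
proof (cases "x = 0")
  case True
  then show ?thesis
    using fin zero by (auto simp: card_gt_0_iff power_0_left)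
next
  case False
  have inj: "inj_on ((*) x) (S - {0})"
    using False by (auto simp: inj_on_def)
  have "(*) x ` (S - {0}) \<subseteq> S - {0}"
    using False x mult by auto
  then have img: "(*) x ` (S - {0}) = S - {0}"
    using inj fin by (intro endo_inj_surj) auto
  have "\<Prod>(S - {0}) = (\<Prod>y\<in>S - {0}. x * y)"
    using prod.reindex[OF inj, of id] by (simp add: img)
  also have "\<dots> = x ^ card (S - {0}) * \<Prod>(S - {0})"
    by (simp add: prod.distrib)
  finally have "x ^ card (S - {0}) = 1"
    using fin by auto
  moreover have "card S = Suc (card (S - {0}))"
    using fin zero by (metis card_Suc_Diff1)
  ultimately show ?thesis
    by simp
qed

lemma power_CARD_eq_self: "x ^ CARD('f) = (x :: 'f::{finite,field})"
  by (rule power_card_eq_self[of UNIV]) auto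

lemma one_less_CARD_field: "1 < CARD('f::{finite,field})"
proof -
  have "card {0, 1 :: 'f} \<le> CARD('f)"
    by (intro card_mono) auto
  then show ?thesis
    by simp
qed

text \<open>
  The polynomial \<open>(X + 1)^q - X^q - 1\<close> has degree less than \<open>q\<close> and vanishes on all of \<open>F\<^sub>q\<close>, so it
  is zero. This yields the additivity of \<open>x \<mapsto> x^q\<close> without writing \<open>q\<close> as a prime power.
\<close>

lemma binomial_CARD_eq_0:
  assumes "0 < k" "k < CARD('f)"
  shows "of_nat (CARD('f) choose k) = (0 :: 'f::{finite,field})"
proof -
  define q where "q = CARD('f)"
  define p :: "'f poly" where "p = (\<Sum>k\<in>{1..<q}. monom (of_nat (q choose k)) k)"
  have q: "1 < q"
    unfolding q_def by (rule one_less_CARD_field)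
  have root: "poly p x = 0" for x
  proof -
    have "{..q} = insert 0 (insert q {1..<q})"
      using q by auto
    then have "(x + 1) ^ q = 1 + (x ^ q + poly p x)"
      using q by (simp add: binomial_ring p_def poly_sum poly_monom)
    then show ?thesis
      unfolding q_def power_CARD_eq_self by simp
  qed
  have "p = 0"
  proof (rule ccontr)
    assume "p \<noteq> 0"
    then have "card {x. poly p x = 0} \<le> degree p"
      by (rule card_poly_roots_bound)
    moreover have "degree p \<le> q - 1"
      unfolding p_def by (intro degree_sum_le) (auto intro: order.trans[OF degree_monom_le])
    ultimately show False
      using root q by (simp add: q_def)
  qed
  moreover have "coeff p k = of_nat (q choose k)"
    using assms by (simp add: p_def coeff_sum q_def)
  ultimately show ?thesis
    by (simp add: q_def)
qed

lemma power_fixed_points_bound: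
  assumes "1 < n"
  shows "finite {x :: 'k::field. x ^ n = x}" and "card {x :: 'k. x ^ n = x} \<le> n"
proof -
  let ?p = "monom 1 n - monom 1 1 :: 'k poly"
  have "coeff ?p n = 1"
    using assms by simp
  then have "?p \<noteq> 0"
    by (metis coeff_0 zero_neq_one)
  then have bound: "card {x. poly ?p x = 0} \<le> degree ?p" and finite: "finite {x. poly ?p x = 0}"
    by (rule card_poly_roots_bound, rule poly_roots_finite)
  show "finite {x :: 'k. x ^ n = x}"
    using finite by (simp add: poly_monom)
  have "degree ?p \<le> n"
    using assms by (intro degree_diff_le) (auto simp: degree_monom_eq)
  then show "card {x :: 'k. x ^ n = x} \<le> n"
    using bound by (simp add: poly_monom)
qed

lemma card_polys_degree_less:
  assumes "0 < n"
  shows "finite {p :: 'f::{finite,field} poly. degree p < n}"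
    and "card {p :: 'f poly. degree p < n} = CARD('f) ^ n"
proof -
  let ?A = "{p :: 'f poly. degree p < n}" and ?B = "{..<n} \<rightarrow>\<^sub>E (UNIV :: 'f set)"
  have bij: "bij_betw (\<lambda>p. restrict (coeff p) {..<n}) ?A ?B"
  proof (rule bij_betw_byWitness[where f' = "\<lambda>f. \<Sum>i<n. monom (f i) i"])
    show "\<forall>p\<in>?A. (\<Sum>i<n. monom (restrict (coeff p) {..<n} i) i) = p"
      by (auto intro!: poly_eqI simp: coeff_sum coeff_eq_0)
    show "\<forall>f\<in>?B. restrict (coeff (\<Sum>i<n. monom (f i) i)) {..<n} = f"
      by (auto simp: coeff_sum fun_eq_iff PiE_def extensional_def)
    show "(\<lambda>f. \<Sum>i<n. monom (f i) i) ` ?B \<subseteq> ?A"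
    proof safe
      fix f :: "nat \<Rightarrow> 'f"
      have "degree (\<Sum>i<n. monom (f i) i) \<le> n - 1"
        by (intro degree_sum_le) (auto intro: order.trans[OF degree_monom_le])
      with assms show "degree (\<Sum>i<n. monom (f i) i) < n"
        by simp
    qed
  qed (auto split: if_splits)
  have fin: "finite ?B"
    by (intro finite_PiE) auto
  show "finite ?A"
    using bij_betw_finite[OF bij] fin by simp
  show "card ?A = CARD('f) ^ n"
    using bij_betw_same_card[OF bij] by (simp add: card_PiE)
qed

section \<open>Twisted polynomials over a field containing a finite field\<close>

text \<open>
  The setting of the twisted polynomial ring: a ring homomorphism \<open>\<gamma>\<close> from \<open>F\<^sub>q[T]\<close> makes the
  field an extension of \<open>F\<^sub>q\<close>. The parameter \<open>q\<close> only abbreviates the cardinality of \<open>F\<^sub>q\<close>.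
\<close>

locale A_field =
  fixes \<gamma> :: "'f::{finite,field} poly \<Rightarrow> 'k::field"
    and q :: nat
  assumes q_eq: "q = CARD('f)" and \<gamma>_1: "\<gamma> 1 = 1"
    and \<gamma>_add: "\<gamma> (a + b) = \<gamma> a + \<gamma> b"
    and \<gamma>_mult: "\<gamma> (a * b) = \<gamma> a * \<gamma> b"
begin

abbreviation tw (infixl "\<star>" 70) where
  "f \<star> g \<equiv> tw_mult q f (g :: 'k poly)"

lemma \<gamma>_0: "\<gamma> 0 = 0"
  using \<gamma>_add[of 0 0] by (metis add_0 add_cancel_right_left)

lemma \<gamma>_minus: "\<gamma> (- a) = - \<gamma> a"
  using \<gamma>_add[of a "- a"] by (simp add: \<gamma>_0 eq_neg_iff_add_eq_0 add.commute)

lemma \<gamma>_diff: "\<gamma> (a - b) = \<gamma> a - \<gamma> b"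
  using \<gamma>_add[of a "- b"] by (simp add: \<gamma>_minus)

lemma \<gamma>_power: "\<gamma> (a ^ n) = \<gamma> a ^ n"
  by (induction n) (auto simp: \<gamma>_1 \<gamma>_mult)

lemma \<gamma>_of_nat: "\<gamma> (of_nat n) = of_nat n"
  by (induction n) (auto simp: \<gamma>_1 \<gamma>_0 \<gamma>_add)

lemma \<gamma>_pCons: "\<gamma> (pCons c p) = \<gamma> [:c:] + \<gamma> T_poly * \<gamma> p"
proof -
  have "pCons c p = [:c:] + T_poly * p"
    by simp
  then show ?thesis
    by (simp only: \<gamma>_add \<gamma>_mult)
qed

lemma \<gamma>_const_power: "\<gamma> [:c:] ^ (q ^ n) = \<gamma> [:c:]"
proof -
  have "\<gamma> [:c:] ^ q = \<gamma> [:c:]"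
    by (simp add: \<gamma>_power[symmetric] q_eq power_CARD_eq_self poly_const_pow)
  then show ?thesis
    by (induction n) (auto simp: power_mult)
qed

lemma q_gt_1: "1 < q"
  unfolding q_eq by (rule one_less_CARD_field)

lemma q_pos [simp]: "0 < q"
  using q_gt_1 by simp

text \<open>
  The inner binomial coefficients vanish in \<open>F\<^sub>q\<close>, hence also in the extension field.
\<close>

lemma frob_add: "(x + y :: 'k) ^ q = x ^ q + y ^ q"
proof -
  have coeff: "of_nat (q choose k) = (0 :: 'k)" if "0 < k" "k < q" for k
    using that binomial_CARD_eq_0[of k, where 'f='f] \<gamma>_of_nat[of "q choose k"]
    by (simp add: of_nat_poly \<gamma>_0 q_eq)
  have "{..q} = insert 0 (insert q {1..<q})"
    using q_gt_1 by auto
  then have "(x + y) ^ q = y ^ q + (x ^ q + (\<Sum>k\<in>{1..<q}. of_nat (q choose k) * x ^ k * y ^ (q - k)))"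
    using q_gt_1 by (simp add: binomial_ring)
  also have "(\<Sum>k\<in>{1..<q}. of_nat (q choose k) * x ^ k * y ^ (q - k)) = 0"
    by (intro sum.neutral) (auto simp: coeff)
  finally show ?thesis
    by simp
qed

lemma frob_power_add: "(x + y :: 'k) ^ (q ^ n) = x ^ (q ^ n) + y ^ (q ^ n)"
  by (induction n) (auto simp: power_mult frob_add power_mult[of _ q, symmetric] mult.commute[of q])

lemma frob_power_0 [simp]: "(0 :: 'k) ^ (q ^ n) = 0"
  using q_gt_1 by (auto simp: power_0_left)

lemma frob_power_minus: "(- x :: 'k) ^ (q ^ n) = - (x ^ (q ^ n))"
  using frob_power_add[of x "- x" n] by (simp add: eq_neg_iff_add_eq_0 add.commute)

lemma frob_power_sum: "(\<Sum>i\<in>A. f i :: 'k) ^ (q ^ n) = (\<Sum>i\<in>A. f i ^ (q ^ n))"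
  by (induction A rule: infinite_finite_induct) (auto simp: frob_power_add)

text \<open>
  The convolution formula, from which the ring axioms follow coefficientwise.
\<close>

lemma coeff_tw_mult: "coeff (f \<star> g) n = (\<Sum>i\<le>n. coeff f i * coeff g (n - i) ^ (q ^ i))"
proof -
  have "coeff (f \<star> g) n =
      (\<Sum>i\<le>degree f. \<Sum>j\<le>degree g. if i + j = n then coeff f i * coeff g j ^ (q ^ i) else 0)"
    by (simp add: tw_mult_def coeff_sum)
  also have "\<dots> = (\<Sum>i\<le>degree f. if i \<le> n then coeff f i * coeff g (n - i) ^ (q ^ i) else 0)"
  proof (rule sum.cong[OF refl])
    fix i
    have "(\<Sum>j\<le>degree g. if i + j = n then coeff f i * coeff g j ^ (q ^ i) else 0) =
        (\<Sum>j\<le>degree g. if j = n - i then (if i \<le> n then coeff f i * coeff g (n - i) ^ (q ^ i) else 0) else 0)"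
      by (intro sum.cong) auto
    also have "\<dots> = (if i \<le> n then coeff f i * coeff g (n - i) ^ (q ^ i) else 0)"
      by (auto simp: coeff_eq_0)
    finally show "(\<Sum>j\<le>degree g. if i + j = n then coeff f i * coeff g j ^ (q ^ i) else 0) = \<dots>" .
  qed
  also have "\<dots> = (\<Sum>i\<in>{..degree f} \<inter> {..n}. coeff f i * coeff g (n - i) ^ (q ^ i))"
    by (subst sum.inter_restrict) auto
  also have "\<dots> = (\<Sum>i\<le>n. coeff f i * coeff g (n - i) ^ (q ^ i))"
    by (intro sum.mono_neutral_left) (auto simp: coeff_eq_0)
  finally show ?thesis .
qed

lemma tw_add_left: "(f + g) \<star> h = f \<star> h + g \<star> h"
  by (rule poly_eqI) (simp add: coeff_tw_mult algebra_simps sum.distrib)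

lemma tw_add_right: "f \<star> (g + h) = f \<star> g + f \<star> h"
  by (rule poly_eqI) (simp add: coeff_tw_mult frob_power_add algebra_simps sum.distrib)

lemma tw_0_left [simp]: "0 \<star> f = 0"
  by (rule poly_eqI) (simp add: coeff_tw_mult)

lemma tw_0_right [simp]: "f \<star> 0 = 0"
  by (rule poly_eqI) (simp add: coeff_tw_mult)

lemma tw_const_left: "[:c:] \<star> f = smult c f"
proof (rule poly_eqI)
  fix n
  have "coeff ([:c:] \<star> f) n = (\<Sum>i\<le>n. if i = 0 then c * coeff f n else 0)"
    unfolding coeff_tw_mult by (intro sum.cong) (auto simp: coeff_pCons split: nat.splits)
  then show "coeff ([:c:] \<star> f) n = coeff (smult c f) n"
    by simp
qed

lemma coeff_tw_const_right: "coeff (f \<star> [:c:]) n = coeff f n * c ^ (q ^ n)"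
proof -
  have "coeff (f \<star> [:c:]) n = (\<Sum>i\<le>n. if i = n then coeff f n * c ^ (q ^ n) else 0)"
    unfolding coeff_tw_mult by (intro sum.cong) (auto simp: coeff_pCons split: nat.splits)
  then show ?thesis
    by simp
qed

lemma tw_assoc: "(f \<star> g) \<star> h = f \<star> (g \<star> h)"
proof (rule poly_eqI)
  fix n
  have "coeff ((f \<star> g) \<star> h) n =
      (\<Sum>(i, j)\<in>Sigma {..n} (\<lambda>i. {..i}).
         coeff f j * coeff g (i - j) ^ (q ^ j) * coeff h (n - i) ^ (q ^ i))"
    by (simp add: coeff_tw_mult sum_distrib_right sum.Sigma)
  also have "\<dots> = (\<Sum>(j, k)\<in>Sigma {..n} (\<lambda>j. {..n - j}).
         coeff f j * (coeff g k * coeff h (n - j - k) ^ (q ^ k)) ^ (q ^ j))"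
    by (rule sum.reindex_bij_witness[of _ "\<lambda>(j, k). (j + k, j)" "\<lambda>(i, j). (j, i - j)"])
      (auto simp: power_mult_distrib power_mult[symmetric] power_add[symmetric] mult.assoc)
  also have "\<dots> = coeff (f \<star> (g \<star> h)) n"
    by (simp add: coeff_tw_mult sum_distrib_left frob_power_sum sum.Sigma)
  finally show "coeff ((f \<star> g) \<star> h) n = coeff (f \<star> (g \<star> h)) n" .
qed

lemma coeff_tw_monom_left: "coeff (monom c m \<star> f) (m + n) = c * coeff f n ^ (q ^ m)"
proof -
  have "coeff (monom c m \<star> f) (m + n) = (\<Sum>i\<le>m + n. if i = m then c * coeff f n ^ (q ^ m) else 0)"
    unfolding coeff_tw_mult by (intro sum.cong) auto
  then show ?thesis
    by simp
qed

lemma coeff_tw_monom_right: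
  "coeff (f \<star> monom c m) n = (if m \<le> n then coeff f (n - m) * c ^ (q ^ (n - m)) else 0)"
proof -
  have "coeff (f \<star> monom c m) n =
      (\<Sum>i\<le>n. if i = n - m then (if m \<le> n then coeff f (n - m) * c ^ (q ^ (n - m)) else 0) else 0)"
    unfolding coeff_tw_mult by (intro sum.cong) auto
  then show ?thesis
    by simp
qed

lemma coeff_tw_linear_right:
  "coeff (f \<star> [:b\<^sub>0, b\<^sub>1:]) n = coeff f n * b\<^sub>0 ^ (q ^ n) +
     (if 1 \<le> n then coeff f (n - 1) * b\<^sub>1 ^ (q ^ (n - 1)) else 0)"
proof -
  have "[:b\<^sub>0, b\<^sub>1:] = monom b\<^sub>0 0 + monom b\<^sub>1 1"
    by (simp add: monom_altdef)
  then show ?thesis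
    by (simp add: tw_add_right coeff_tw_monom_right)
qed

lemma coeff_tw_quadratic_right:
  "coeff (f \<star> [:b\<^sub>0, b\<^sub>1, b\<^sub>2:]) n = coeff f n * b\<^sub>0 ^ (q ^ n) +
     (if 1 \<le> n then coeff f (n - 1) * b\<^sub>1 ^ (q ^ (n - 1)) else 0) +
     (if 2 \<le> n then coeff f (n - 2) * b\<^sub>2 ^ (q ^ (n - 2)) else 0)"
proof -
  have "[:b\<^sub>0, b\<^sub>1, b\<^sub>2:] = monom b\<^sub>0 0 + monom b\<^sub>1 1 + monom b\<^sub>2 2"
    by (simp add: monom_altdef numeral_2_eq_2)
  then show ?thesis
    by (simp add: tw_add_right coeff_tw_monom_right)
qed

lemma coeff_tw_top: "coeff (f \<star> g) (degree f + degree g) = lead_coeff f * lead_coeff g ^ (q ^ degree f)"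
proof -
  have "coeff (f \<star> g) (degree f + degree g) =
      (\<Sum>i\<in>{degree f}. coeff f i * coeff g (degree f + degree g - i) ^ (q ^ i))"
    unfolding coeff_tw_mult
  proof (rule sum.mono_neutral_right)
    show "\<forall>i\<in>{..degree f + degree g} - {degree f}.
        coeff f i * coeff g (degree f + degree g - i) ^ (q ^ i) = 0"
    proof
      fix i assume "i \<in> {..degree f + degree g} - {degree f}"
      then have "i > degree f \<or> degree f + degree g - i > degree g"
        by auto
      then show "coeff f i * coeff g (degree f + degree g - i) ^ (q ^ i) = 0"
        by (auto simp: coeff_eq_0)
    qed
  qed auto
  then show ?thesis
    by simp
qed

lemma degree_tw:
  assumes "f \<noteq> 0" "g \<noteq> 0"
  shows "degree (f \<star> g) = degree f + degree g"
proof (rule antisym)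
  show "degree (f \<star> g) \<le> degree f + degree g"
    unfolding tw_mult_def
    by (intro degree_sum_le) (auto intro!: order.trans[OF degree_monom_le] add_mono)
  show "degree f + degree g \<le> degree (f \<star> g)"
    using assms by (intro le_degree) (simp add: coeff_tw_top)
qed

lemma tw_eval_eq: "degree f \<le> n \<Longrightarrow> tw_eval q f x = (\<Sum>i\<le>n. coeff f i * x ^ (q ^ i))"
  unfolding tw_eval_def by (intro sum.mono_neutral_left) (auto simp: coeff_eq_0)

lemma tw_eval_0 [simp]: "tw_eval q 0 x = 0"
  by (simp add: tw_eval_def)

lemma tw_eval_zero_arg [simp]: "tw_eval q f (0 :: 'k) = 0"
  by (simp add: tw_eval_def)

lemma tw_eval_const [simp]: "tw_eval q [:c:] x = c * x"
  by (simp add: tw_eval_def)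

lemma tw_eval_add: "tw_eval q (f + g) x = tw_eval q f x + tw_eval q g x"
proof -
  define n where "n = max (degree f) (degree g)"
  have "degree f \<le> n" "degree g \<le> n" "degree (f + g) \<le> n"
    by (auto simp: n_def degree_add_le_max)
  then show ?thesis
    by (simp add: tw_eval_eq algebra_simps sum.distrib)
qed

lemma tw_eval_monom: "tw_eval q (monom c n) x = c * x ^ (q ^ n)"
proof -
  have "tw_eval q (monom c n) x = (\<Sum>i\<le>n. if i = n then c * x ^ (q ^ n) else 0)"
    unfolding tw_eval_eq[OF degree_monom_le] by (intro sum.cong) auto
  then show ?thesis
    by simp
qed

lemma tw_eval_sum: "tw_eval q (\<Sum>i\<in>A. f i) x = (\<Sum>i\<in>A. tw_eval q (f i) x)"
  by (induction A rule: infinite_finite_induct) (auto simp: tw_eval_add)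

lemma tw_eval_tw: "tw_eval q (f \<star> g) x = tw_eval q f (tw_eval q g x)"
  by (simp add: tw_mult_def tw_eval_sum tw_eval_monom)
    (simp add: tw_eval_def frob_power_sum sum_distrib_left power_mult_distrib
      power_mult[symmetric] power_add[symmetric] mult.assoc add.commute)

section \<open>Drinfeld modules\<close>

lemma \<gamma>_const_eq_0_iff: "\<gamma> [:c:] = 0 \<longleftrightarrow> c = 0"
proof
  assume *: "\<gamma> [:c:] = 0"
  show "c = 0"
  proof (rule ccontr)
    assume "c \<noteq> 0"
    then have "[:c:] * [:inverse c:] = 1"
      by simp
    then have "\<gamma> [:c:] * \<gamma> [:inverse c:] = 1"
      by (metis \<gamma>_mult \<gamma>_1)
    with * show False
      by simp
  qed
qed (simp add: \<gamma>_0)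

text \<open>
  The Horner step that carries all inductions over \<open>F\<^sub>q[T]\<close> below. As a rewrite rule it would loop,
  since the constant \<open>T\<close> is itself of the form \<open>pCons c p\<close>.
\<close>

lemma drinfeld_pCons:
  assumes "drinfeld_module \<gamma> r \<phi>"
  shows "\<phi> (pCons c p) = [:\<gamma> [:c:]:] + \<phi> p \<star> \<phi> T_poly"
proof -
  have "pCons c p = [:c:] + p * T_poly"
    by simp
  then show ?thesis
    using assms by (simp only: drinfeld_module_def q_eq)
qed

lemma drinfeld_const:
  assumes "drinfeld_module \<gamma> r \<phi>"
  shows "\<phi> [:c:] = [:\<gamma> [:c:]:]"
  using assms by (simp only: drinfeld_module_def)

lemma drinfeld_0:
  assumes "drinfeld_module \<gamma> r \<phi>"
  shows "\<phi> 0 = 0"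
  using drinfeld_const[OF assms, of 0] by (simp add: \<gamma>_0)

lemma drinfeld_commute:
  assumes "drinfeld_module \<gamma> r \<phi>"
  shows "\<phi> a \<star> \<phi> b = \<phi> b \<star> \<phi> a"
  using assms by (metis drinfeld_module_def q_eq mult.commute)

lemma drinfeld_eqI:
  assumes "drinfeld_module \<gamma> r \<phi>" "drinfeld_module \<gamma> s \<psi>" "\<phi> T_poly = \<psi> T_poly"
  shows "\<phi> = \<psi>"
proof
  fix a show "\<phi> a = \<psi> a"
  proof (induction a)
    case 0
    then show ?case
      by (simp add: drinfeld_0[OF assms(1)] drinfeld_0[OF assms(2)])
  next
    case (pCons c p)
    then show ?case
      by (simp only: drinfeld_pCons[OF assms(1), of c p] drinfeld_pCons[OF assms(2), of c p] assms(3))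
  qed
qed

lemma degree_drinfeld:
  assumes D: "drinfeld_module \<gamma> r \<phi>" and "a \<noteq> 0"
  shows "\<phi> a \<noteq> 0 \<and> degree (\<phi> a) = r * degree a"
  using \<open>a \<noteq> 0\<close>
proof (induction a)
  case (pCons c p)
  have r: "0 < r" "degree (\<phi> T_poly) = r" "\<phi> T_poly \<noteq> 0"
    using D by (auto simp: drinfeld_module_def)
  show ?case
  proof (cases "p = 0")
    case True
    then show ?thesis
      using pCons by (simp add: drinfeld_const[OF D] \<gamma>_const_eq_0_iff)
  next
    case False
    then have deg: "degree (\<phi> p \<star> \<phi> T_poly) = r * degree (pCons c p)"
      using pCons r by (simp add: degree_tw)
    then have "degree (\<phi> (pCons c p)) = r * degree (pCons c p)"
      unfolding drinfeld_pCons[OF D, of c p] using False r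
      by (subst degree_add_eq_right) auto
    then show ?thesis
      using False r by auto
  qed
qed simp

text \<open>
  \<open>F\<^sub>q[T]\<close> is the free \<open>F\<^sub>q\<close>-algebra on \<open>T\<close>, so \<open>\<phi>\<^sub>T\<close> can be prescribed, subject to its constant
  term: the Horner scheme in \<open>K{\<tau>}\<close> defines \<open>\<phi>\<close>, and it is multiplicative because \<open>P\<close> commutes
  with the constants from \<open>F\<^sub>q\<close>.
\<close>

lemma drinfeld_module_exists:
  assumes P0: "coeff P 0 = \<gamma> T_poly" and r: "degree P = r" "0 < r"
  obtains \<phi> where "drinfeld_module \<gamma> r \<phi>" "\<phi> T_poly = P"
proof
  define \<phi> where "\<phi> a = fold_coeffs (\<lambda>c f. [:\<gamma> [:c:]:] + f \<star> P) a 0" for a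
  have \<phi>_0: "\<phi> 0 = 0"
    by (simp add: \<phi>_def)
  have \<phi>_pCons: "\<phi> (pCons c p) = [:\<gamma> [:c:]:] + \<phi> p \<star> P" for c p
    by (cases "c = 0 \<and> p = 0") (auto simp: \<phi>_def \<gamma>_0)
  have \<phi>_const: "\<phi> [:c:] = [:\<gamma> [:c:]:]" for c
    by (simp add: \<phi>_pCons \<phi>_0)
  have \<phi>_add: "\<phi> (a + b) = \<phi> a + \<phi> b" for a b
  proof (induction a b rule: poly_induct2)
    case (pCons a p b s)
    have "\<gamma> [:a + b:] = \<gamma> [:a:] + \<gamma> [:b:]"
      by (simp add: \<gamma>_add[symmetric])
    then show ?case
      by (simp add: \<phi>_pCons pCons tw_add_left)
  qed (simp add: \<phi>_0)
  have \<phi>_smult: "\<phi> (smult c b) = smult (\<gamma> [:c:]) (\<phi> b)" for c b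
  proof (induction b)
    case (pCons b p)
    have "\<gamma> [:c * b:] = \<gamma> [:c:] * \<gamma> [:b:]"
      by (simp add: \<gamma>_mult[symmetric] mult.commute)
    moreover have "smult x f \<star> P = smult x (f \<star> P)" for x f
      by (simp add: tw_const_left[symmetric] tw_assoc)
    ultimately show ?case
      by (simp add: \<phi>_pCons pCons smult_add_right)
  qed (simp add: \<phi>_0)
  have P_const: "P \<star> [:\<gamma> [:c:]:] = [:\<gamma> [:c:]:] \<star> P" for c
    by (rule poly_eqI) (simp add: coeff_tw_const_right tw_const_left \<gamma>_const_power)
  have P_commute: "P \<star> \<phi> b = \<phi> b \<star> P" for b
  proof (induction b)
    case (pCons b p)
    have "P \<star> (\<phi> p \<star> P) = \<phi> p \<star> P \<star> P"
      by (simp only: tw_assoc[symmetric] pCons.IH)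
    then show ?case
      by (simp add: \<phi>_pCons tw_add_left tw_add_right P_const)
  qed (simp add: \<phi>_0)
  have \<phi>_mult: "\<phi> (a * b) = \<phi> a \<star> \<phi> b" for a b
  proof (induction a)
    case (pCons a p)
    have "\<phi> (pCons a p * b) = smult (\<gamma> [:a:]) (\<phi> b) + (\<phi> p \<star> \<phi> b) \<star> P"
      by (simp add: \<phi>_add \<phi>_smult \<phi>_pCons pCons \<gamma>_0)
    also have "\<dots> = \<phi> (pCons a p) \<star> \<phi> b"
      by (simp add: \<phi>_pCons tw_add_left tw_const_left tw_assoc P_commute)
    finally show ?case .
  qed (simp add: \<phi>_0)
  have coeff_0: "coeff (\<phi> a) 0 = \<gamma> a" for a
  proof (induction a)
    case (pCons a p)
    have "coeff (\<phi> (pCons a p)) 0 = \<gamma> [:a:] + \<gamma> p * \<gamma> T_poly"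
      by (simp add: \<phi>_pCons coeff_tw_mult pCons P0)
    then show ?case
      by (simp add: \<gamma>_pCons[of a p] mult.commute)
  qed (simp add: \<phi>_0 \<gamma>_0)
  show T: "\<phi> T_poly = P"
    using \<gamma>_1 by (simp add: \<phi>_pCons \<phi>_0 \<gamma>_0 one_pCons tw_const_left)
  show "drinfeld_module \<gamma> r \<phi>"
    using r unfolding drinfeld_module_def q_eq[symmetric]
    by (simp add: \<phi>_add \<phi>_mult \<phi>_const coeff_0 T)
qed

lemma coeff_conj: "coeff ([:inverse c:] \<star> f \<star> [:c:]) n = inverse c * coeff f n * c ^ (q ^ n)"
  by (simp add: coeff_tw_const_right tw_const_left)

text \<open>
  The modules isomorphic to \<open>\<phi>\<close> over \<open>K\<close> are the conjugates by nonzero constants.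
\<close>

lemma drinfeld_conj:
  assumes D: "drinfeld_module \<gamma> r \<phi>" and c: "c \<noteq> 0"
  shows "drinfeld_module \<gamma> r (\<lambda>a. [:inverse c:] \<star> \<phi> a \<star> [:c:])"
proof -
  have c_inverse: "[:c:] \<star> [:inverse c:] = 1"
    using c by (simp add: tw_const_left one_pCons)
  have one: "1 \<star> f = f" for f :: "'k poly"
    by (simp add: one_pCons tw_const_left)
  have "[:inverse c:] \<star> (\<phi> a \<star> \<phi> b) \<star> [:c:] =
      [:inverse c:] \<star> \<phi> a \<star> ([:c:] \<star> [:inverse c:]) \<star> \<phi> b \<star> [:c:]" for a b
    unfolding c_inverse by (simp add: tw_assoc one)
  then have "[:inverse c:] \<star> (\<phi> a \<star> \<phi> b) \<star> [:c:] =
      ([:inverse c:] \<star> \<phi> a \<star> [:c:]) \<star> ([:inverse c:] \<star> \<phi> b \<star> [:c:])" for a b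
    by (simp add: tw_assoc)
  moreover have "degree ([:inverse c:] \<star> \<phi> T_poly \<star> [:c:]) = degree (\<phi> T_poly)"
  proof -
    have "\<phi> T_poly \<noteq> 0"
      using D by (auto simp: drinfeld_module_def)
    then show ?thesis
      using c by (simp add: tw_const_left degree_tw)
  qed
  ultimately show ?thesis
    using D c unfolding drinfeld_module_def q_eq[symmetric]
    by (auto simp: coeff_tw_const_right tw_add_left tw_add_right tw_const_left)
qed

text \<open>
  If \<open>\<phi>\<^sub>T x = 0\<close>, then \<open>T\<close> acts as zero on \<open>x\<close>, and only the constant term of \<open>a\<close> acts.
\<close>

lemma tw_eval_T_torsion:
  assumes D: "drinfeld_module \<gamma> r \<phi>" and x: "tw_eval q (\<phi> T_poly) x = 0"
  shows "tw_eval q (\<phi> a) x = \<gamma> [:coeff a 0:] * x"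
proof (cases a)
  case (pCons c p)
  then show ?thesis
    by (simp add: drinfeld_pCons[OF D, of c p] tw_eval_add tw_eval_tw x)
qed

text \<open>
  Think of \<open>\<mu>\<close> as a logarithm of \<open>\<phi>\<close> that is exact below \<open>\<tau>^d\<close> and has the error \<open>e \<tau>^d\<close> there. The
  error for \<open>\<phi>\<^sub>a\<close> is a derivation in \<open>a\<close>: modulo \<open>\<tau>^(d+1)\<close>, the term \<open>\<tau>^d\<close> passes
  through \<open>\<phi>\<^sub>T\<close> as the scalar \<open>\<alpha>^(q^d) = \<alpha>\<close>, so each factor \<open>T\<close> of \<open>a\<close> contributes the same amount.
\<close>

lemma drinfeld_mod_tau:
  assumes D: "drinfeld_module \<gamma> r \<phi>"
    and \<mu>: "\<And>n. n \<le> d \<Longrightarrow>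
      coeff (\<mu> \<star> \<phi> T_poly) n = \<gamma> T_poly * coeff \<mu> n + (if n = d then e else 0)"
    and \<alpha>: "\<gamma> T_poly ^ (q ^ d) = \<gamma> T_poly"
    and "n \<le> d"
  shows "coeff (\<mu> \<star> \<phi> a) n = \<gamma> a * coeff \<mu> n + (if n = d then e * \<gamma> (pderiv a) else 0)"
  using \<open>n \<le> d\<close>
proof (induction a arbitrary: n)
  case 0
  then show ?case
    by (simp add: drinfeld_0[OF D] \<gamma>_0)
next
  case (pCons c p)
  have T0: "coeff (\<phi> T_poly) 0 = \<gamma> T_poly"
    using D by (simp add: drinfeld_module_def)
  have "coeff ((\<mu> \<star> \<phi> p) \<star> \<phi> T_poly) n =
      (\<Sum>i\<le>n. (\<gamma> p * coeff \<mu> i + (if i = d then e * \<gamma> (pderiv p) else 0))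
         * coeff (\<phi> T_poly) (n - i) ^ (q ^ i))"
    unfolding coeff_tw_mult[of "\<mu> \<star> \<phi> p"]
    using pCons.prems by (intro sum.cong) (auto simp: pCons.IH)
  also have "\<dots> = (\<Sum>i\<le>n. \<gamma> p * (coeff \<mu> i * coeff (\<phi> T_poly) (n - i) ^ (q ^ i)) +
      (if i = d then e * \<gamma> (pderiv p) * coeff (\<phi> T_poly) (n - i) ^ (q ^ i) else 0))"
    by (intro sum.cong) (auto simp: algebra_simps)
  also have "\<dots> = \<gamma> p * coeff (\<mu> \<star> \<phi> T_poly) n +
      (\<Sum>i\<le>n. if i = d then e * \<gamma> (pderiv p) * coeff (\<phi> T_poly) (n - i) ^ (q ^ i) else 0)"
    by (simp only: coeff_tw_mult sum_distrib_left sum.distrib)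
  also have "(\<Sum>i\<le>n. if i = d then e * \<gamma> (pderiv p) * coeff (\<phi> T_poly) (n - i) ^ (q ^ i) else 0) =
      (if n = d then e * \<gamma> (pderiv p) * \<gamma> T_poly else 0)"
    using pCons.prems by (auto simp: T0 \<alpha>)
  finally have main: "coeff ((\<mu> \<star> \<phi> p) \<star> \<phi> T_poly) n =
      \<gamma> p * (\<gamma> T_poly * coeff \<mu> n + (if n = d then e else 0)) +
      (if n = d then e * \<gamma> (pderiv p) * \<gamma> T_poly else 0)"
    by (simp only: \<mu>[OF pCons.prems])
  have "\<gamma> (pderiv (pCons c p)) = \<gamma> p + \<gamma> T_poly * \<gamma> (pderiv p)"
    using \<gamma>_pCons[of 0 "pderiv p"] by (simp add: pderiv_pCons \<gamma>_add \<gamma>_0)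
  moreover have "coeff (\<mu> \<star> \<phi> (pCons c p)) n =
      coeff \<mu> n * \<gamma> [:c:] + coeff ((\<mu> \<star> \<phi> p) \<star> \<phi> T_poly) n"
    by (simp add: drinfeld_pCons[OF D, of c p] tw_add_right tw_assoc coeff_tw_const_right \<gamma>_const_power)
  ultimately show ?case
    by (auto simp: main \<gamma>_pCons[of c p] algebra_simps)
qed

text \<open>
  When \<open>\<gamma> a = 0\<close>, only the error term is left in the preceding formula. A factor \<open>\<mu>\<close> with constant
  term \<open>1\<close> does not change the lowest coefficient, so this term is the coefficient of \<open>\<phi>\<^sub>a\<close> itself.
\<close>

lemma drinfeld_coeff_eq:
  assumes D: "drinfeld_module \<gamma> r \<phi>"
    and \<mu>: "\<And>n. n \<le> d \<Longrightarrow>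
      coeff (\<mu> \<star> \<phi> T_poly) n = \<gamma> T_poly * coeff \<mu> n + (if n = d then e else 0)"
    and \<mu>_0: "coeff \<mu> 0 = 1"
    and \<alpha>: "\<gamma> T_poly ^ (q ^ d) = \<gamma> T_poly"
    and a: "\<gamma> a = 0"
  shows "coeff (\<phi> a) d = e * \<gamma> (pderiv a)"
proof -
  have eq: "coeff (\<phi> a) n = (if n = d then e * \<gamma> (pderiv a) else 0)" if "n \<le> d" for n
    using that
  proof (induction n rule: less_induct)
    case (less n)
    have "(if n = d then e * \<gamma> (pderiv a) else 0) = coeff (\<mu> \<star> \<phi> a) n"
      using drinfeld_mod_tau[OF D \<mu> \<alpha> less.prems, of a] a by simp
    also have "\<dots> = (\<Sum>i\<in>{0}. coeff \<mu> i * coeff (\<phi> a) (n - i) ^ (q ^ i))"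
      unfolding coeff_tw_mult using less by (intro sum.mono_neutral_right) auto
    finally show ?case
      by (simp add: \<mu>_0)
  qed
  show ?thesis
    using eq[of d] by simp
qed

section \<open>Reduction of the polynomials \<open>p\<^sub>i\<close>\<close>

text \<open>
  The subring of \<open>F\<^sub>q(T)\<close> on which reduction is defined: the localization of \<open>F\<^sub>q[T]\<close> at the kernel
  of \<open>\<gamma>\<close>.
\<close>

definition loc_ring :: "'f poly fract set" where
  "loc_ring = {Fract a b | a b. \<gamma> b \<noteq> 0}"

lemma loc_ringI: "\<gamma> b \<noteq> 0 \<Longrightarrow> Fract a b \<in> loc_ring"
  by (auto simp: loc_ring_def)

lemma loc_ringE:
  assumes "x \<in> loc_ring"
  obtains a b where "x = Fract a b" "\<gamma> b \<noteq> 0" "b \<noteq> 0"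
  using assms \<gamma>_0 by (auto simp: loc_ring_def)

lemma fract_red_Fract:
  assumes "\<gamma> b \<noteq> 0"
  shows "fract_red \<gamma> (Fract a b) = \<gamma> a / \<gamma> b"
  unfolding fract_red_def
proof (rule the_equality)
  fix y
  assume "\<exists>a' b'. \<gamma> b' \<noteq> 0 \<and> Fract a b = Fract a' b' \<and> y = \<gamma> a' / \<gamma> b'"
  then obtain a' b' where *: "\<gamma> b' \<noteq> 0" "Fract a b = Fract a' b'" "y = \<gamma> a' / \<gamma> b'"
    by auto
  have "b \<noteq> 0" "b' \<noteq> 0"
    using assms * \<gamma>_0 by auto
  then have "a * b' = a' * b"
    using * by (simp add: eq_fract)
  then have "\<gamma> a * \<gamma> b' = \<gamma> a' * \<gamma> b"
    by (simp add: \<gamma>_mult[symmetric])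
  then show "y = \<gamma> a / \<gamma> b"
    using assms * by (simp add: frac_eq_eq)
qed (use assms in auto)

lemma loc_ring_0 [simp]: "0 \<in> loc_ring"
  and loc_ring_1 [simp]: "1 \<in> loc_ring"
  and fract_red_0 [simp]: "fract_red \<gamma> 0 = 0"
  and fract_red_1 [simp]: "fract_red \<gamma> 1 = 1"
  unfolding Zero_fract_def One_fract_def by (simp_all add: loc_ringI fract_red_Fract \<gamma>_1 \<gamma>_0)

lemma loc_ring_add: "x \<in> loc_ring \<Longrightarrow> y \<in> loc_ring \<Longrightarrow> x + y \<in> loc_ring"
  and fract_red_add: "x \<in> loc_ring \<Longrightarrow> y \<in> loc_ring \<Longrightarrow>
    fract_red \<gamma> (x + y) = fract_red \<gamma> x + fract_red \<gamma> y"
  by (auto elim!: loc_ringE simp: loc_ringI fract_red_Fract \<gamma>_mult \<gamma>_add field_simps)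

lemma loc_ring_mult: "x \<in> loc_ring \<Longrightarrow> y \<in> loc_ring \<Longrightarrow> x * y \<in> loc_ring"
  and fract_red_mult: "x \<in> loc_ring \<Longrightarrow> y \<in> loc_ring \<Longrightarrow>
    fract_red \<gamma> (x * y) = fract_red \<gamma> x * fract_red \<gamma> y"
  by (auto elim!: loc_ringE simp: loc_ringI fract_red_Fract \<gamma>_mult)

lemma loc_ring_sum: "(\<And>i. i \<in> A \<Longrightarrow> f i \<in> loc_ring) \<Longrightarrow> sum f A \<in> loc_ring"
  by (induction A rule: infinite_finite_induct) (auto intro: loc_ring_add)

lemma fract_red_sum:
  "(\<And>i. i \<in> A \<Longrightarrow> f i \<in> loc_ring) \<Longrightarrow> fract_red \<gamma> (sum f A) = (\<Sum>i\<in>A. fract_red \<gamma> (f i))"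
  by (induction A rule: infinite_finite_induct) (auto simp: fract_red_add loc_ring_sum)

definition loc_poly :: "'f poly fract poly \<Rightarrow> bool" where
  "loc_poly p \<longleftrightarrow> (\<forall>i. coeff p i \<in> loc_ring)"

abbreviation poly_red :: "'f poly fract poly \<Rightarrow> 'k poly" where
  "poly_red \<equiv> map_poly (fract_red \<gamma>)"

lemma loc_poly_add: "loc_poly f \<Longrightarrow> loc_poly g \<Longrightarrow> loc_poly (f + g)"
  by (simp add: loc_poly_def loc_ring_add)

lemma poly_red_add: "loc_poly f \<Longrightarrow> loc_poly g \<Longrightarrow> poly_red (f + g) = poly_red f + poly_red g"
  by (rule poly_eqI) (simp add: coeff_map_poly loc_poly_def fract_red_add)

lemma loc_poly_mult: "loc_poly f \<Longrightarrow> loc_poly g \<Longrightarrow> loc_poly (f * g)"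
  by (auto simp: loc_poly_def coeff_mult intro!: loc_ring_sum loc_ring_mult)

lemma poly_red_mult: "loc_poly f \<Longrightarrow> loc_poly g \<Longrightarrow> poly_red (f * g) = poly_red f * poly_red g"
  by (rule poly_eqI)
    (simp add: coeff_map_poly loc_poly_def coeff_mult fract_red_sum fract_red_mult loc_ring_mult)

lemma loc_poly_monom: "c \<in> loc_ring \<Longrightarrow> loc_poly (monom c n)"
  and poly_red_monom: "poly_red (monom c n) = monom (fract_red \<gamma> c) n"
  by (auto simp: loc_poly_def map_poly_monom)

lemma loc_ring_T_quotient:
  assumes "\<gamma> T_poly \<noteq> 0"
  defines "x m \<equiv> (Fract T_poly 1 ^ m - 1) / Fract T_poly 1 ^ m"
  shows "x m \<in> loc_ring" and "fract_red \<gamma> (x m) = (\<gamma> T_poly ^ m - 1) / \<gamma> T_poly ^ m"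
proof -
  have power: "Fract T_poly 1 ^ m = Fract (T_poly ^ m) (1 :: 'f poly)"
    by (induction m) (auto simp: One_fract_def)
  have "x m = Fract ((T_poly ^ m - 1) * 1) (1 * T_poly ^ m)"
    unfolding x_def power by (simp add: One_fract_def)
  then have x: "x m = Fract (T_poly ^ m - 1) (T_poly ^ m)"
    by simp
  have "\<gamma> (T_poly ^ m) \<noteq> 0"
    using assms(1) by (simp add: \<gamma>_power)
  then show "x m \<in> loc_ring" "fract_red \<gamma> (x m) = (\<gamma> T_poly ^ m - 1) / \<gamma> T_poly ^ m"
    unfolding x by (simp_all add: loc_ringI fract_red_Fract \<gamma>_diff \<gamma>_power \<gamma>_1)
qed

text \<open>
  The recursion in a form built only from sums and products of monomials, the operations that are
  shown to commute with reduction.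
\<close>

lemma p_shift_Suc_Suc:
  fixes i :: nat
  defines "t \<equiv> (Fract T_poly 1 ^ (q ^ i - 1) - 1) / Fract T_poly 1 ^ (q ^ i - 1) :: 'f poly fract"
  shows "p_shift (Suc (Suc i)) =
    (monom 1 (q ^ i) + monom (- 1) 0) * p_shift (Suc i) + monom t (q ^ i) * p_shift i"
  by (simp add: t_def q_eq Let_def smult_monom minus_monom[symmetric] one_pCons monom_0)

lemma loc_poly_p_shift:
  assumes T: "\<gamma> T_poly \<noteq> 0"
  shows "loc_poly (p_shift i)"
proof (induction i rule: induct_nat_012)
  case 0
  then show ?case
    by (simp add: loc_poly_def)
next
  case 1
  then show ?case
    by (auto simp: loc_poly_def coeff_1)
next
  case (ge2 i)
  have "- 1 = Fract (- 1) (1 :: 'f poly)"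
    by (simp add: One_fract_def)
  then have "- 1 \<in> loc_ring"
    by (simp add: loc_ringI \<gamma>_1)
  then show ?case
    unfolding p_shift_Suc_Suc using ge2
    by (intro loc_poly_add loc_poly_mult loc_poly_monom loc_ring_T_quotient(1)[OF T]) auto
qed

lemma poly_red_p_shift:
  assumes T: "\<gamma> T_poly \<noteq> 0"
  defines "P i x \<equiv> poly (poly_red (p_shift i)) x"
  shows "P 0 x = 0" and "P (Suc 0) x = 1"
    and "P (Suc (Suc i)) x = (x ^ (q ^ i) - 1) * P (Suc i) x +
      (\<gamma> T_poly ^ (q ^ i - 1) - 1) / \<gamma> T_poly ^ (q ^ i - 1) * x ^ (q ^ i) * P i x"
proof -
  show "P 0 x = 0" "P (Suc 0) x = 1"
    by (simp_all add: P_def map_poly_1)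
  have minus_1: "- 1 = Fract (- 1) (1 :: 'f poly)"
    by (simp add: One_fract_def)
  then have "- 1 \<in> loc_ring"
    by (simp add: loc_ringI \<gamma>_1)
  have red_minus_1: "fract_red \<gamma> (- 1) = - 1"
    unfolding minus_1 by (simp add: fract_red_Fract \<gamma>_minus \<gamma>_1)
  note loc = loc_poly_p_shift[OF T] \<open>- 1 \<in> loc_ring\<close> loc_ring_T_quotient(1)[OF T]
  show "P (Suc (Suc i)) x = (x ^ (q ^ i) - 1) * P (Suc i) x +
      (\<gamma> T_poly ^ (q ^ i - 1) - 1) / \<gamma> T_poly ^ (q ^ i - 1) * x ^ (q ^ i) * P i x"
    unfolding P_def p_shift_Suc_Suc
    by (simp add: poly_red_add poly_red_mult poly_red_monom loc loc_poly_add loc_poly_mult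
        loc_poly_monom red_minus_1 loc_ring_T_quotient(2)[OF T] poly_monom)
qed

end

section \<open>Supersingularity in finite characteristic\<close>

locale A_field_char = A_field \<gamma> q
  for \<gamma> :: "'f::{finite,field} poly \<Rightarrow> 'k::alg_closed_field" and q :: nat +
  fixes L :: "'f poly"
  assumes irreducible_L: "irreducible L"
    and \<gamma>_eq_0_iff: "\<gamma> a = 0 \<longleftrightarrow> L dvd a"
begin

abbreviation d :: nat where
  "d \<equiv> degree L"

abbreviation \<alpha> :: 'k where
  "\<alpha> \<equiv> \<gamma> T_poly"

lemma L_nonzero: "L \<noteq> 0"
  using irreducible_L by auto

lemma d_pos: "0 < d"
  using irreducible_L L_nonzero by (auto simp: irreducible_def is_unit_iff_degree)

text \<open>
  Every residue class modulo \<open>L\<close> has exactly one representative of degree less than \<open>d\<close>.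
\<close>

lemma finite_residue_field: "finite (range \<gamma>)"
  and card_residue_field: "card (range \<gamma>) = q ^ d"
proof -
  have img: "range \<gamma> = \<gamma> ` {p. degree p < d}"
  proof (intro equalityI subsetI)
    fix x assume "x \<in> range \<gamma>"
    then obtain a where a: "x = \<gamma> a"
      by auto
    have "\<gamma> a = \<gamma> (a div L * L + a mod L)"
      by simp
    also have "\<dots> = \<gamma> (a mod L)"
      unfolding \<gamma>_add \<gamma>_mult using \<gamma>_eq_0_iff[of L] by simp
    finally have "x = \<gamma> (a mod L)"
      using a by simp
    then show "x \<in> \<gamma> ` {p. degree p < d}"
      using degree_mod_less'[of L a] L_nonzero d_pos by (cases "a mod L = 0") auto
  qed auto
  have inj: "inj_on \<gamma> {p. degree p < d}"
  proof (rule inj_onI)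
    fix a b assume *: "a \<in> {p. degree p < d}" "b \<in> {p. degree p < d}" "\<gamma> a = \<gamma> b"
    then have "L dvd a - b"
      by (simp add: \<gamma>_eq_0_iff[symmetric] \<gamma>_diff)
    moreover have "degree (a - b) < d"
      using * by (simp add: degree_diff_less)
    ultimately show "a = b"
      using dvd_imp_degree_le[of L "a - b"] by auto
  qed
  show "finite (range \<gamma>)"
    unfolding img using card_polys_degree_less(1)[OF d_pos] by (rule finite_imageI)
  show "card (range \<gamma>) = q ^ d"
    unfolding img card_image[OF inj] q_eq by (rule card_polys_degree_less(2)[OF d_pos])
qed

lemma residue_field_power:
  assumes "x \<in> range \<gamma>"
  shows "x ^ (q ^ d) = x"
proof -
  have "x * y \<in> range \<gamma>" if "x \<in> range \<gamma>" "y \<in> range \<gamma>" for x y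
    using that by (auto simp: \<gamma>_mult[symmetric])
  moreover have "0 \<in> range \<gamma>"
    using \<gamma>_0 by (metis rangeI)
  ultimately show ?thesis
    using power_card_eq_self[OF finite_residue_field _ _ assms] by (simp add: card_residue_field)
qed

lemma \<alpha>_power_d: "\<alpha> ^ (q ^ d) = \<alpha>"
  by (rule residue_field_power) auto

text \<open>
  \<open>\<alpha>\<close> generates \<open>F\<^sub>L\<close> over \<open>F\<^sub>q\<close>: if \<open>x \<mapsto> x^(q^r)\<close> fixes \<open>\<alpha>\<close>, it fixes all \<open>q^d\<close> elements
  of \<open>F\<^sub>L\<close>, which are then roots of \<open>X^(q^r) - X\<close>. For the remainder \<open>r < d\<close> of \<open>m\<close> this forces
  \<open>r = 0\<close>.
\<close>

lemma \<alpha>_power_eq_imp_dvd: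
  assumes "\<alpha> ^ (q ^ m) = \<alpha>"
  shows "d dvd m"
proof -
  define r where "r = m mod d"
  have \<alpha>_mult: "\<alpha> ^ (q ^ (d * k)) = \<alpha>" for k
    by (induction k) (simp_all add: power_add power_mult \<alpha>_power_d)
  have "\<alpha> ^ (q ^ (d * (m div d) + r)) = (\<alpha> ^ (q ^ (d * (m div d)))) ^ (q ^ r)"
    by (simp add: power_add power_mult)
  then have \<alpha>: "\<alpha> ^ (q ^ r) = \<alpha>"
    using assms by (simp add: \<alpha>_mult r_def)
  have fixed: "\<gamma> a ^ (q ^ r) = \<gamma> a" for a
  proof (induction a)
    case (pCons c p)
    then show ?case
      by (simp add: \<gamma>_pCons[of c p] frob_power_add power_mult_distrib \<gamma>_const_power \<alpha>)
  qed (simp add: \<gamma>_0)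
  have "r = 0"
  proof (rule ccontr)
    assume "r \<noteq> 0"
    then have r: "1 < q ^ r"
      using one_less_power[OF q_gt_1] by simp
    have "range \<gamma> \<subseteq> {x. x ^ (q ^ r) = x}"
      using fixed by auto
    then have "q ^ d \<le> q ^ r"
      using power_fixed_points_bound[OF r, where 'k = 'k]
      by (metis card_mono card_residue_field order.trans)
    then have "d \<le> r"
      using q_gt_1 by simp
    then show False
      using mod_less_divisor[OF d_pos, of m] by (simp add: r_def)
  qed
  then show ?thesis
    by (simp add: r_def dvd_eq_mod_eq_0)
qed

text \<open>
  Separability of \<open>L\<close>: it divides \<open>T^(q^d) - T\<close>, whose derivative is \<open>-1\<close>.
\<close>

lemma \<gamma>_pderiv_L_nonzero: "\<gamma> (pderiv L) \<noteq> 0"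
proof
  assume *: "\<gamma> (pderiv L) = 0"
  define n where "n = q ^ d"
  have "\<gamma> (monom 1 n) = \<alpha> ^ n"
    by (simp add: \<gamma>_power[symmetric] monom_altdef)
  then have "\<gamma> (monom 1 n - T_poly) = 0"
    by (simp add: \<gamma>_diff \<alpha>_power_d n_def)
  then obtain M where M: "monom 1 n - T_poly = L * M"
    by (auto simp: \<gamma>_eq_0_iff)
  have "of_nat q = (0 :: 'f)"
    using binomial_CARD_eq_0[of 1, where 'f = 'f] q_gt_1 by (simp add: q_eq)
  then have "of_nat n = (0 :: 'f)"
    using d_pos by (simp add: n_def)
  then have "pderiv (monom 1 n - T_poly) = - (1 :: 'f poly)"
    by (simp add: pderiv_diff pderiv_monom pderiv_pCons one_pCons)
  then have "- 1 = L * pderiv M + M * pderiv L"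
    by (simp add: M pderiv_mult)
  then have "\<gamma> (- 1) = \<gamma> L * \<gamma> (pderiv M) + \<gamma> M * \<gamma> (pderiv L)"
    by (simp only: \<gamma>_add \<gamma>_mult)
  then show False
    using * \<gamma>_eq_0_iff[of L] by (simp add: \<gamma>_minus \<gamma>_1)
qed

text \<open>
  Compare the lowest terms of \<open>\<phi>\<^sub>L \<phi>\<^sub>T = \<phi>\<^sub>T \<phi>\<^sub>L\<close>: they are \<open>c \<alpha>^(q^n)\<close> and \<open>\<alpha> c\<close>. So the height of a
  Drinfeld module of characteristic \<open>L\<close> is a multiple of \<open>d\<close>.
\<close>

lemma drinfeld_L_lowest_index:
  assumes D: "drinfeld_module \<gamma> r \<phi>"
    and low: "\<And>i. i < n \<Longrightarrow> coeff (\<phi> L) i = 0" and n: "coeff (\<phi> L) n \<noteq> 0"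
  shows "d dvd n" "0 < n"
proof -
  let ?c = "coeff (\<phi> L) n"
  have T0: "coeff (\<phi> a) 0 = \<gamma> a" for a
    using D by (simp add: drinfeld_module_def)
  show "0 < n"
    using n T0[of L] \<gamma>_eq_0_iff[of L] by (cases n) auto
  have "coeff (\<phi> L \<star> \<phi> T_poly) n = (\<Sum>i\<in>{n}. coeff (\<phi> L) i * coeff (\<phi> T_poly) (n - i) ^ (q ^ i))"
    unfolding coeff_tw_mult using low by (intro sum.mono_neutral_right) auto
  moreover have "coeff (\<phi> T_poly \<star> \<phi> L) n = (\<Sum>i\<in>{0}. coeff (\<phi> T_poly) i * coeff (\<phi> L) (n - i) ^ (q ^ i))"
    unfolding coeff_tw_mult using low by (intro sum.mono_neutral_right) auto
  ultimately have "?c * \<alpha> ^ (q ^ n) = ?c * \<alpha>"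
    using drinfeld_commute[OF D, of L T_poly] by (auto simp: T0 mult.commute[of \<alpha>])
  then have "\<alpha> ^ (q ^ n) = \<alpha>"
    using n by simp
  then show "d dvd n"
    by (rule \<alpha>_power_eq_imp_dvd)
qed

text \<open>
  The lowest index is \<open>d\<close> or \<open>2d\<close>, and the degree is \<open>2d\<close>.
\<close>

lemma hasse_zero_imp_monom:
  assumes D: "drinfeld_module \<gamma> 2 \<phi>" and hasse: "coeff (\<phi> L) d = 0"
  obtains c where "c \<noteq> 0" "\<phi> L = monom c (2 * d)"
proof -
  have deg: "\<phi> L \<noteq> 0" "degree (\<phi> L) = 2 * d"
    using degree_drinfeld[OF D L_nonzero] by auto
  define n where "n = (LEAST n. coeff (\<phi> L) n \<noteq> 0)"
  have top: "coeff (\<phi> L) (2 * d) \<noteq> 0"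
    using deg by (metis leading_coeff_0_iff)
  have n: "coeff (\<phi> L) n \<noteq> 0"
    unfolding n_def using top by (rule LeastI)
  have low: "coeff (\<phi> L) i = 0" if "i < n" for i
    using not_less_Least[OF that[unfolded n_def]] by simp
  obtain k where k: "n = d * k" and "0 < n"
    using drinfeld_L_lowest_index[OF D low n] by auto
  have "k \<noteq> 0" "k \<noteq> 1"
    using \<open>0 < n\<close> n hasse k by auto
  moreover have "n \<le> 2 * d"
    using le_degree[OF n] deg by simp
  ultimately have "n = 2 * d"
    using k d_pos by (cases "k = 2") auto
  have "\<phi> L = monom (coeff (\<phi> L) (2 * d)) (2 * d)"
  proof (rule poly_eqI)
    fix i
    show "coeff (\<phi> L) i = coeff (monom (coeff (\<phi> L) (2 * d)) (2 * d)) i"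
      using low[of i] deg \<open>n = 2 * d\<close> by (cases i "2 * d" rule: linorder_cases) (auto simp: coeff_eq_0)
  qed
  then show ?thesis
    using top that by blast
qed

text \<open>
  Here \<open>d\<close> is the lowest index of \<open>\<phi>\<^sub>L\<close>. Dividing the additive polynomial of \<open>\<phi>\<^sub>L\<close> by \<open>x^(q^d)\<close>
  leaves a nonconstant polynomial with nonzero constant term, and a root of it is a nonzero
  \<open>L\<close>-torsion point.
\<close>

lemma hasse_nonzero_imp_torsion:
  assumes D: "drinfeld_module \<gamma> 2 \<phi>" and hasse: "coeff (\<phi> L) d \<noteq> 0"
  obtains x where "x \<noteq> 0" "tw_eval q (\<phi> L) x = 0"
proof -
  have deg: "\<phi> L \<noteq> 0" "degree (\<phi> L) = 2 * d"
    using degree_drinfeld[OF D L_nonzero] by auto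
  define n where "n = (LEAST n. coeff (\<phi> L) n \<noteq> 0)"
  have n: "coeff (\<phi> L) n \<noteq> 0"
    unfolding n_def using hasse by (rule LeastI)
  have low': "coeff (\<phi> L) i = 0" if "i < n" for i
    using not_less_Least[OF that[unfolded n_def]] by simp
  have "d \<le> n"
    using drinfeld_L_lowest_index[OF D low' n] by (intro dvd_imp_le) auto
  then have low: "coeff (\<phi> L) i = 0" if "i < d" for i
    using low'[of i] that by simp
  define p where "p = (\<Sum>i\<in>{d..2 * d}. monom (coeff (\<phi> L) i) (q ^ i - q ^ d))"
  have less: "q ^ i < q ^ j" if "i < j" for i j
    using that q_gt_1 by simp
  have coeff_p: "coeff p (q ^ j - q ^ d) = coeff (\<phi> L) j" if "j \<in> {d..2 * d}" for j
  proof -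
    have "q ^ i - q ^ d = q ^ j - q ^ d \<longleftrightarrow> i = j" if "i \<in> {d..2 * d}" for i
    proof
      assume *: "q ^ i - q ^ d = q ^ j - q ^ d"
      have "q ^ d \<le> q ^ i" "q ^ d \<le> q ^ j"
        using that \<open>j \<in> _\<close> q_gt_1 by auto
      then have "q ^ i = q ^ j"
        using * by linarith
      then show "i = j"
        using q_gt_1 by simp
    qed simp
    then have "coeff p (q ^ j - q ^ d) = (\<Sum>i\<in>{d..2 * d}. if i = j then coeff (\<phi> L) j else 0)"
      unfolding p_def coeff_sum by (intro sum.cong) auto
    then show ?thesis
      using that by simp
  qed
  have p0: "poly p 0 \<noteq> 0"
    using coeff_p[of d] hasse by (simp add: poly_0_coeff_0)
  have "coeff p (q ^ (2 * d) - q ^ d) \<noteq> 0"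
    using coeff_p[of "2 * d"] deg by (metis leading_coeff_0_iff atLeastAtMost_iff le_add1 mult_2 order_refl)
  then have "q ^ (2 * d) - q ^ d \<le> degree p"
    by (rule le_degree)
  moreover have "q ^ d < q ^ (2 * d)"
    using d_pos by (intro less) simp
  ultimately have "0 < degree p"
    by linarith
  then obtain x where x: "poly p x = 0"
    using alg_closed_imp_poly_has_root by blast
  have "tw_eval q (\<phi> L) x = (\<Sum>i\<le>2 * d. coeff (\<phi> L) i * x ^ (q ^ i))"
    using deg by (simp add: tw_eval_def)
  also have "\<dots> = (\<Sum>i\<in>{d..2 * d}. coeff (\<phi> L) i * x ^ (q ^ i))"
    by (intro sum.mono_neutral_right) (auto intro: low)
  also have "\<dots> = x ^ (q ^ d) * poly p x"
    unfolding p_def poly_sum sum_distrib_left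
  proof (rule sum.cong[OF refl])
    fix i assume "i \<in> {d..2 * d}"
    then have "q ^ i = q ^ d + (q ^ i - q ^ d)"
      using q_gt_1 by simp
    then have "x ^ (q ^ i) = x ^ (q ^ d) * x ^ (q ^ i - q ^ d)"
      by (metis power_add)
    then show "coeff (\<phi> L) i * x ^ (q ^ i) = x ^ (q ^ d) * poly (monom (coeff (\<phi> L) i) (q ^ i - q ^ d)) x"
      by (simp add: poly_monom)
  qed
  finally have "tw_eval q (\<phi> L) x = 0"
    by (simp add: x)
  moreover have "x \<noteq> 0"
    using x p0 by auto
  ultimately show ?thesis
    using that by blast
qed

lemma supersingular_iff_hasse:
  assumes D: "drinfeld_module \<gamma> 2 \<phi>"
  shows "supersingular L \<phi> \<longleftrightarrow> coeff (\<phi> L) d = 0"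
proof
  assume "supersingular L \<phi>"
  then show "coeff (\<phi> L) d = 0"
    using hasse_nonzero_imp_torsion[OF D] unfolding supersingular_def q_eq[symmetric] by metis
next
  assume "coeff (\<phi> L) d = 0"
  then obtain c where "c \<noteq> 0" "\<phi> L = monom c (2 * d)"
    using hasse_zero_imp_monom[OF D] by blast
  then show "supersingular L \<phi>"
    unfolding supersingular_def q_eq[symmetric] by (simp add: tw_eval_monom)
qed

lemma supersingular_conj:
  assumes "supersingular L \<phi>" and c: "c \<noteq> 0"
  shows "supersingular L (\<lambda>a. [:inverse c:] \<star> \<phi> a \<star> [:c:])"
  using assms unfolding supersingular_def q_eq[symmetric] by (auto simp: tw_eval_tw)

text \<open>
  This puts the parameter into \<open>F\<^sub>L\<^sup>(\<^sup>2\<^sup>)\<close>. Commutation with \<open>\<phi>\<^sub>L = c \<tau>^(2d)\<close> alone yields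
  \<open>u^(q^(2d)) = c^(q\<^sup>2-1) u\<close>; the rational subgroup \<open>x^q = -x\<close> of the \<open>T\<close>-torsion, special to modules
  of this type, shows that \<open>c\<close> lies in \<open>F\<^sub>q\<close>.
\<close>

lemma supersingular_parameter_power:
  assumes D: "drinfeld_module \<gamma> 2 \<phi>" and ss: "supersingular L \<phi>"
    and T: "\<phi> T_poly = [:\<alpha>, u + \<alpha>, u:]"
  shows "u ^ (q ^ (2 * d)) = u"
proof -
  obtain c where c: "c \<noteq> 0" "\<phi> L = monom c (2 * d)"
    using hasse_zero_imp_monom[OF D] supersingular_iff_hasse[OF D] ss by metis
  \<comment> \<open>A nonzero element killed by \<open>\<tau> + 1\<close>.\<close>
  obtain x :: 'k where x: "x ^ (q - 1) = - 1"
    using nth_root_exists[of "q - 1" "- 1 :: 'k"] q_gt_1 by auto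
  have "x \<noteq> 0"
    using x q_gt_1 by (auto simp: power_0_left split: if_splits)
  have xq: "x ^ q = - x"
    using x q_gt_1 power_minus_mult[of q x] by simp
  have xqq: "x ^ (q ^ (2 * k)) = x" for k
  proof (induction k)
    case (Suc k)
    have "x ^ (q ^ (2 * Suc k)) = ((x ^ (q ^ (2 * k))) ^ q) ^ q"
      by (simp add: power_mult[symmetric] mult.commute)
    also have "\<dots> = x"
      using Suc frob_power_minus[of x 1] by (simp add: xq)
    finally show ?case .
  qed simp
  have "tw_eval q (\<phi> T_poly) x = \<alpha> * x + (u + \<alpha>) * x ^ q + u * x ^ (q ^ (2 * 1))"
    by (simp add: T tw_eval_eq[of _ 2] numeral_2_eq_2)
  also have "\<dots> = 0"
    unfolding xqq xq by (simp add: algebra_simps)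
  finally have "tw_eval q (\<phi> L) x = \<gamma> [:coeff L 0:] * x"
    by (rule tw_eval_T_torsion[OF D])
  then have "c = \<gamma> [:coeff L 0:]"
    using \<open>x \<noteq> 0\<close> by (simp add: c tw_eval_monom xqq)
  then have cq: "c ^ (q ^ n) = c" for n
    by (simp add: \<gamma>_const_power)
  have "coeff (monom c (2 * d) \<star> \<phi> T_poly) (2 * d + 2) =
      coeff (\<phi> T_poly \<star> monom c (2 * d)) (2 * d + 2)"
    using drinfeld_commute[OF D, of L T_poly] by (simp add: c)
  then have "c * u ^ (q ^ (2 * d)) = u * c"
    unfolding coeff_tw_monom_left coeff_tw_monom_right cq by (simp add: T numeral_2_eq_2)
  then show ?thesis
    using c by simp
qed

end

section \<open>The Hasse coefficient as a value of \<open>p\<^sub>d\<close>\<close>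

text \<open>
  The truncated logarithm \<open>lam\<close> of \<open>\<psi>\<^sub>T = (\<tau> + 1)(u \<tau> + \<alpha>)\<close> is
  \<open>\<Sum>n<d. w\<^sub>n p\<^sub>n(s) \<tau>^n\<close> with \<open>s = -u/\<alpha>^q\<close>, where the weights \<open>w\<^sub>n\<close> absorb the denominators
  \<open>\<alpha>^(q^i) - \<alpha>\<close>. Then \<open>lam (\<tau> + 1)\<close> is a truncated logarithm of \<open>\<phi>\<close>, because
  \<open>(\<tau> + 1) \<phi>\<^sub>T = \<psi>\<^sub>T (\<tau> + 1)\<close>, and its error at \<open>\<tau>^d\<close> is a nonzero multiple of \<open>p\<^sub>d(s)\<close>.
\<close>

lemma (in A_field_char) hasse_iff_p_root:
  assumes D: "drinfeld_module \<gamma> 2 \<phi>" and T: "\<phi> T_poly = [:\<alpha>, u + \<alpha>, u:]" and \<alpha>: "\<alpha> \<noteq> 0"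
  shows "coeff (\<phi> L) d = 0 \<longleftrightarrow> poly (p_red \<gamma> d) (- u / \<alpha> ^ q) = 0"
proof -
  \<comment> \<open>\<open>P (Suc n)\<close> is the value of \<open>p\<^sub>n\<close>, by the index shift in \<open>p_shift\<close>.\<close>
  define P where "P i = poly (map_poly (fract_red \<gamma>) (p_shift i)) (- u / \<alpha> ^ q)" for i
  have P_0: "P 0 = 0" and P_1: "P (Suc 0) = 1"
    by (simp_all add: P_def poly_red_p_shift[OF \<alpha>])
  \<comment> \<open>The recursion of the \<open>p\<^sub>i\<close>, multiplied by \<open>-\<alpha>^(q^(i+1))\<close> so that the coefficient of
      \<open>P (Suc i)\<close> becomes the \<open>q^i\<close>-th power of the middle coefficient \<open>u + \<alpha>^q\<close> of \<open>\<psi>\<^sub>T\<close>.\<close>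
  have P_rec: "- (\<alpha> ^ (q ^ Suc i)) * P (Suc (Suc i)) =
      (u ^ (q ^ i) + \<alpha> ^ (q ^ Suc i)) * P (Suc i) +
      (\<alpha> ^ (q ^ i) - \<alpha>) / \<alpha> ^ (q ^ i) * u ^ (q ^ i) * P i" for i
  proof -
    have "(- u / \<alpha> ^ q) ^ (q ^ i) = - (u ^ (q ^ i)) / \<alpha> ^ (q ^ Suc i)"
      by (simp only: power_divide frob_power_minus power_mult power_Suc)
    moreover have "(\<alpha> ^ (q ^ i - 1) - 1) / \<alpha> ^ (q ^ i - 1) = (\<alpha> ^ (q ^ i) - \<alpha>) / \<alpha> ^ (q ^ i)"
    proof -
      have "\<alpha> ^ (q ^ i) = \<alpha> * \<alpha> ^ (q ^ i - 1)"
        using power_minus_mult[of "q ^ i" \<alpha>] by (simp add: mult.commute)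
      then show ?thesis
        using \<alpha> by (simp add: field_simps)
    qed
    ultimately have "P (Suc (Suc i)) = (- (u ^ (q ^ i)) / \<alpha> ^ (q ^ Suc i) - 1) * P (Suc i) +
        (\<alpha> ^ (q ^ i) - \<alpha>) / \<alpha> ^ (q ^ i) * (- (u ^ (q ^ i)) / \<alpha> ^ (q ^ Suc i)) * P i"
      by (simp only: P_def poly_red_p_shift(3)[OF \<alpha>])
    moreover have "- b * ((- v / b - 1) * x + t * (- v / b) * y) = (v + b) * x + t * v * y"
      if "b \<noteq> 0" for b v x t y :: 'k
      using that by (simp add: field_simps)
    moreover have "\<alpha> ^ (q ^ Suc i) \<noteq> 0"
      using \<alpha> by simp
    ultimately show ?thesis
      by (simp only:)
  qed
  have \<alpha>_ne: "\<alpha> ^ (q ^ i) - \<alpha> \<noteq> 0" if "0 < i" "i < d" for i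
    using \<alpha>_power_eq_imp_dvd[of i] that nat_dvd_not_less[of i d] by auto
  define w where "w n = (\<Prod>i = 1..n. \<alpha> ^ (q ^ i) / (\<alpha> ^ (q ^ i) - \<alpha>))" for n
  have w_0: "w 0 = 1"
    by (simp add: w_def)
  have w_Suc: "w (Suc n) * (\<alpha> ^ (q ^ Suc n) - \<alpha>) = w n * \<alpha> ^ (q ^ Suc n)" if "Suc n < d" for n
    using \<alpha>_ne[of "Suc n"] that by (simp add: w_def)
  have w_ne: "w n \<noteq> 0" if "n < d" for n
    using \<alpha>_ne \<alpha> that by (auto simp: w_def)
  define lam where "lam = (\<Sum>n<d. monom (w n * P (Suc n)) n)"
  have coeff_lam: "coeff lam n = (if n < d then w n * P (Suc n) else 0)" for n
    by (simp add: lam_def coeff_sum)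
  define \<psi>T where "\<psi>T = [:\<alpha>, u + \<alpha> ^ q, u ^ q:]"
  \<comment> \<open>The coefficient of \<open>\<tau>^d\<close> in \<open>lam \<psi>\<^sub>T\<close>; \<open>lam\<close> itself has no such term, as \<open>w d\<close> would
      require division by \<open>\<alpha>^(q^d) - \<alpha> = 0\<close>.\<close>
  define e where "e = - w (d - 1) * \<alpha> * P (Suc d)"
  have lam_\<psi>: "coeff (lam \<star> \<psi>T) n = \<alpha> * coeff lam n + (if n = d then e else 0)" if "n \<le> d" for n
  proof (cases n)
    case 0
    then show ?thesis
      using d_pos by (simp add: \<psi>T_def coeff_tw_quadratic_right)
  next
    case (Suc m)
    \<comment> \<open>For \<open>m = 0\<close> both sides vanish: the factor \<open>P 0 = p\<^sub>-\<^sub>1\<close> on the right is \<open>0\<close>.\<close>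
    have lower: "(if 2 \<le> n then coeff lam (n - 2) * (u ^ q) ^ (q ^ (n - 2)) else 0) =
        w m * ((\<alpha> ^ (q ^ m) - \<alpha>) / \<alpha> ^ (q ^ m) * u ^ (q ^ m) * P m)"
    proof (cases m)
      case 0
      then show ?thesis
        using Suc by (simp add: P_0)
    next
      case (Suc k)
      have "w k = w m * (\<alpha> ^ (q ^ m) - \<alpha>) / \<alpha> ^ (q ^ m)"
        using w_Suc[of k] \<open>n \<le> d\<close> \<open>n = Suc m\<close> Suc \<alpha> by simp
      then show ?thesis
        using \<open>n \<le> d\<close> \<open>n = Suc m\<close> Suc by (simp add: coeff_lam power_mult[symmetric])
    qed
    have "coeff (lam \<star> \<psi>T) n = coeff lam n * \<alpha> ^ (q ^ n) + w m *
        ((u ^ (q ^ m) + \<alpha> ^ (q ^ n)) * P (Suc m) + (\<alpha> ^ (q ^ m) - \<alpha>) / \<alpha> ^ (q ^ m) * u ^ (q ^ m) * P m)"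
      unfolding \<psi>T_def coeff_tw_quadratic_right lower using \<open>n \<le> d\<close> Suc
      by (simp add: coeff_lam frob_power_add power_mult[symmetric] algebra_simps)
    also have "\<dots> = coeff lam n * \<alpha> ^ (q ^ n) - w m * \<alpha> ^ (q ^ n) * P (Suc n)"
      unfolding Suc P_rec[of m, symmetric] by simp
    also have "\<dots> = \<alpha> * coeff lam n + (if n = d then e else 0)"
    proof (cases "n = d")
      case True
      then show ?thesis
        using Suc \<alpha>_power_d by (simp add: coeff_lam e_def flip: True)
    next
      case False
      then have w_m: "w m * \<alpha> ^ (q ^ n) = w n * (\<alpha> ^ (q ^ n) - \<alpha>)"
        using w_Suc[of m] \<open>n \<le> d\<close> Suc by simp
      show ?thesis
        unfolding w_m using False \<open>n \<le> d\<close> by (simp add: coeff_lam algebra_simps)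
    qed
    finally show ?thesis .
  qed
  define A where "A = [:1, 1 :: 'k:]"
  have "\<phi> T_poly = [:\<alpha>, u:] \<star> A"
    unfolding T A_def by (rule poly_eqI)
      (auto simp: coeff_tw_linear_right coeff_pCons split: nat.splits)
  moreover have "\<psi>T = A \<star> [:\<alpha>, u:]"
    unfolding \<psi>T_def A_def by (rule poly_eqI)
      (auto simp: coeff_tw_linear_right coeff_pCons split: nat.splits)
  ultimately have swap: "A \<star> \<phi> T_poly = \<psi>T \<star> A"
    by (simp add: tw_assoc)
  have coeff_A: "coeff (f \<star> A) n = coeff f n + (if 1 \<le> n then coeff f (n - 1) else 0)" for f n
    by (simp add: A_def coeff_tw_linear_right)
  have "coeff (lam \<star> A \<star> \<phi> T_poly) n = \<alpha> * coeff (lam \<star> A) n + (if n = d then e else 0)"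
    if "n \<le> d" for n
    unfolding tw_assoc[of lam] swap unfolding tw_assoc[of lam, symmetric] coeff_A
    using that d_pos by (auto simp: lam_\<psi> algebra_simps)
  moreover have "coeff (lam \<star> A) 0 = 1"
    using d_pos by (simp add: coeff_A coeff_lam w_0 P_1)
  ultimately have "coeff (\<phi> L) d = e * \<gamma> (pderiv L)"
    using \<gamma>_eq_0_iff[of L] by (intro drinfeld_coeff_eq[OF D _ _ \<alpha>_power_d]) auto
  then have "coeff (\<phi> L) d = 0 \<longleftrightarrow> P (Suc d) = 0"
    using \<gamma>_pderiv_L_nonzero \<alpha> w_ne[of "d - 1"] d_pos by (simp add: e_def)
  then show ?thesis
    by (simp add: P_def p_red_def p_poly_def)
qed

section \<open>The quadratic extension\<close>

lemma quadratic_extension_basis: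
  fixes E :: "'l::field alg_closure set"
  assumes "quadratic_extension E"
  obtains v w where "v \<noteq> 0" "\<And>x. w \<noteq> to_ac x * v"
    "E = (\<lambda>(x, y). to_ac x * w + to_ac y * v) ` UNIV"
proof -
  let ?R = "ring_of_type_algebra :: 'l alg_closure ring" and ?K = "range (to_ac :: 'l \<Rightarrow> _)"
  interpret R: ring ?R
    by (rule ring_from_type_algebra)
  have ext: "R.line_extension K v F = {k * v + x |k x. k \<in> K \<and> x \<in> F}" for K v F
    by (auto simp: R.line_extension_mem_iff) (auto simp: ring_of_type_algebra_def)
  have "R.dimension (Suc (Suc 0)) ?K E"
    using assms by (simp add: quadratic_extension_def numeral_2_eq_2)
  then obtain w F where w: "w \<notin> F" "E = R.line_extension ?K w F" and dim_F: "R.dimension (Suc 0) ?K F"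
    by (cases rule: R.dimension.cases) auto
  from dim_F obtain v F0 where v: "v \<notin> F0" "F = R.line_extension ?K v F0" and dim_F0: "R.dimension 0 ?K F0"
    by (cases rule: R.dimension.cases) auto
  from dim_F0 have F0: "F0 = {0}"
    by (cases rule: R.dimension.cases) (auto simp: ring_of_type_algebra_def)
  have F: "F = {to_ac x * v |x. True}"
    by (auto simp: v(2) ext F0)
  show ?thesis
  proof (rule that)
    show "v \<noteq> 0"
      using v F0 by simp
    show "w \<noteq> to_ac x * v" for x
      using w F by auto
    show "E = (\<lambda>(x, y). to_ac x * w + to_ac y * v) ` UNIV"
      by (auto simp: w(2) ext F)
  qed
qed

lemma card_quadratic_extension:
  fixes E :: "'l::field alg_closure set"
  assumes "quadratic_extension E"
  shows "card E = CARD('l)\<^sup>2"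
proof -
  obtain v w where v: "v \<noteq> 0" and w: "\<And>x. w \<noteq> to_ac x * v"
    and E: "E = (\<lambda>(x, y). to_ac x * w + to_ac y * v) ` UNIV"
    using quadratic_extension_basis[OF assms] by blast
  have "inj (\<lambda>(x, y). to_ac x * w + to_ac y * v)"
  proof (rule injI, clarify)
    fix x y x' y'
    assume eq: "to_ac x * w + to_ac y * v = to_ac x' * w + to_ac y' * v"
    then have *: "to_ac (x - x') * w = to_ac (y' - y) * v"
      by (simp add: algebra_simps)
    have "x = x'"
    proof (rule ccontr)
      assume "x \<noteq> x'"
      then have "w = to_ac ((y' - y) / (x - x')) * v"
        using * by (simp add: field_simps)
      with w show False
        by blast
    qed
    with eq v show "x = x' \<and> y = y'"
      by simp
  qed
  then show ?thesis
    unfolding E by (simp add: card_image power2_eq_square)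
qed

text \<open>
  Each element of \<open>E\<close> is fixed by \<open>x \<mapsto> x^n\<close>, where \<open>n\<close> is the number of elements of \<open>E\<close>; and this
  map has no more than \<open>n\<close> fixed points.
\<close>

lemma quadratic_extension_eq:
  fixes E :: "'l::field alg_closure set"
  assumes E: "quadratic_extension E" and fin: "finite (UNIV :: 'l set)"
  shows "E = {x. x ^ (CARD('l)\<^sup>2) = x}"
proof (rule card_seteq)
  let ?n = "CARD('l)\<^sup>2"
  have "card {0, 1 :: 'l} \<le> CARD('l)"
    using fin by (intro card_mono) auto
  then have "2 * 2 \<le> ?n"
    unfolding power2_eq_square by (intro mult_le_mono) auto
  then have n: "1 < ?n"
    by simp
  show "finite {x :: 'l alg_closure. x ^ ?n = x}"
    by (rule power_fixed_points_bound(1)[OF n])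
  show "card {x :: 'l alg_closure. x ^ ?n = x} \<le> card E"
    using power_fixed_points_bound(2)[OF n] by (simp add: card_quadratic_extension[OF E])
  have "subring E ring_of_type_algebra"
    using E subfieldE(1) unfolding quadratic_extension_def by blast
  then have "0 \<in> E" and "\<And>x y. x \<in> E \<Longrightarrow> y \<in> E \<Longrightarrow> x * y \<in> E"
    using subringE(2,6) by (fastforce simp: ring_of_type_algebra_def)+
  moreover have "finite E"
    by (rule ccontr) (use n card_quadratic_extension[OF E] in simp)
  ultimately show "E \<subseteq> {x. x ^ ?n = x}"
    using power_card_eq_self[of E] by (auto simp: card_quadratic_extension[OF E])
qed

section \<open>The correspondences\<close>

context A_field_char
begin

lemma supersingular_of_typeI:
  assumes "drinfeld_module \<gamma> 2 \<phi>" "supersingular L \<phi>" "u \<noteq> 0" "\<phi> T_poly = [:\<alpha>, u + \<alpha>, u:]"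
  shows "\<phi> \<in> supersingular_of_type L \<gamma>"
  using assms unfolding supersingular_of_type_def by blast

lemma supersingular_of_typeE:
  assumes "\<phi> \<in> supersingular_of_type L \<gamma>"
  obtains u where "drinfeld_module \<gamma> 2 \<phi>" "supersingular L \<phi>" "u \<noteq> 0"
    "\<phi> T_poly = [:\<alpha>, u + \<alpha>, u:]" "coeff (\<phi> T_poly) 2 = u"
proof -
  obtain u where u: "drinfeld_module \<gamma> 2 \<phi>" "supersingular L \<phi>" "u \<noteq> 0"
    "\<phi> T_poly = [:\<alpha>, u + \<alpha>, u:]"
    using assms unfolding supersingular_of_type_def by blast
  show ?thesis
    by (rule that[OF u]) (simp add: u(4) numeral_2_eq_2)
qed

lemma inj_on_parameter: "inj_on (\<lambda>\<phi>. coeff (\<phi> T_poly) 2) (supersingular_of_type L \<gamma>)"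
proof (rule inj_onI)
  fix \<phi> \<psi>
  assume \<phi>: "\<phi> \<in> supersingular_of_type L \<gamma>" and \<psi>: "\<psi> \<in> supersingular_of_type L \<gamma>"
    and eq: "coeff (\<phi> T_poly) 2 = coeff (\<psi> T_poly) 2"
  obtain u where u: "drinfeld_module \<gamma> 2 \<phi>" "\<phi> T_poly = [:\<alpha>, u + \<alpha>, u:]" "coeff (\<phi> T_poly) 2 = u"
    using supersingular_of_typeE[OF \<phi>] by blast
  obtain v where v: "drinfeld_module \<gamma> 2 \<psi>" "\<psi> T_poly = [:\<alpha>, v + \<alpha>, v:]" "coeff (\<psi> T_poly) 2 = v"
    using supersingular_of_typeE[OF \<psi>] by blast
  have "\<phi> T_poly = \<psi> T_poly"
    unfolding u(2) v(2) using eq u(3) v(3) by simp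
  then show "\<phi> = \<psi>"
    by (rule drinfeld_eqI[OF u(1) v(1)])
qed

text \<open>
  Conjugation by \<open>c\<close> multiplies the coefficients \<open>g\<close> and \<open>\<Delta>\<close> of \<open>\<psi>\<^sub>T\<close> by \<open>c^(q-1)\<close> and
  \<open>c^(q\<^sup>2-1)\<close>. One root extraction matches \<open>g\<close> with \<open>u + \<alpha>\<close>, and \<open>\<Delta>\<close> then matches \<open>u\<close> because the
  \<open>j\<close>-invariants agree. If \<open>g = 0\<close>, then \<open>u + \<alpha> = 0\<close> as well, and \<open>c\<close> is chosen to match \<open>\<Delta>\<close>.
\<close>

lemma supersingular_same_j:
  assumes D: "drinfeld_module \<gamma> 2 \<psi>" and ss: "supersingular L \<psi>" and u: "u \<noteq> 0"
    and j: "j_invariant \<psi> = (u + \<alpha>) ^ (q + 1) / u"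
  obtains \<phi> where "drinfeld_module \<gamma> 2 \<phi>" "supersingular L \<phi>" "\<phi> T_poly = [:\<alpha>, u + \<alpha>, u:]"
proof -
  define g where "g = coeff (\<psi> T_poly) 1"
  define \<Delta> where "\<Delta> = coeff (\<psi> T_poly) 2"
  have deg: "degree (\<psi> T_poly) = 2" and T0: "coeff (\<psi> T_poly) 0 = \<alpha>"
    using D by (simp_all add: drinfeld_module_def)
  have \<Delta>: "\<Delta> \<noteq> 0"
    using deg unfolding \<Delta>_def by (metis leading_coeff_0_iff degree_0 zero_neq_numeral)
  have j': "g ^ (q + 1) / \<Delta> = (u + \<alpha>) ^ (q + 1) / u"
    using j by (simp add: j_invariant_def g_def \<Delta>_def q_eq)
  have q2: "(q - 1) * (q + 1) = q ^ 2 - 1"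
    by (simp add: power2_eq_square algebra_simps)
  obtain c where c: "c \<noteq> 0" "c ^ (q - 1) * g = u + \<alpha>" "c ^ (q\<^sup>2 - 1) * \<Delta> = u"
  proof (cases "g = 0")
    case True
    have "0 < q\<^sup>2 - 1"
      using one_less_power[OF q_gt_1, of 2] by simp
    then obtain c where c: "c ^ (q\<^sup>2 - 1) = u / \<Delta>"
      using nth_root_exists by blast
    have "u + \<alpha> = 0"
      using j' True u by (simp add: power_0_left)
    moreover have "c \<noteq> 0"
      using c u \<Delta> \<open>0 < q\<^sup>2 - 1\<close> by (auto simp: power_0_left)
    ultimately show ?thesis
      using that[of c] c \<Delta> True by simp
  next
    case False
    then have "u + \<alpha> \<noteq> 0"
      using j' \<Delta> u by auto
    obtain c where c: "c ^ (q - 1) = (u + \<alpha>) / g"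
      using nth_root_exists[of "q - 1"] q_gt_1 by auto
    have "c ^ (q\<^sup>2 - 1) = ((u + \<alpha>) / g) ^ (q + 1)"
      unfolding q2[symmetric] power_mult c ..
    also have "\<dots> = u / \<Delta>"
      using j' False \<Delta> u by (simp add: power_divide frac_eq_eq mult.commute del: power_Suc)
    finally have "c ^ (q\<^sup>2 - 1) * \<Delta> = u"
      using \<Delta> by simp
    moreover have "c \<noteq> 0"
      using c \<open>u + \<alpha> \<noteq> 0\<close> False q_gt_1 by (auto simp: power_0_left)
    ultimately show ?thesis
      using that[of c] c False by simp
  qed
  define \<phi> where "\<phi> a = [:inverse c:] \<star> \<psi> a \<star> [:c:]" for a
  have coeff_\<phi>: "coeff (\<phi> T_poly) n = coeff (\<psi> T_poly) n * c ^ (q ^ n - 1)" for n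
  proof -
    have "c ^ (q ^ n) = c ^ (q ^ n - 1) * c"
      using power_minus_mult[of "q ^ n" c] by simp
    then show ?thesis
      using c(1) by (simp add: \<phi>_def coeff_conj)
  qed
  have "\<phi> T_poly = [:\<alpha>, u + \<alpha>, u:]"
  proof (rule poly_eqI)
    fix n
    consider "n = 0" | "n = 1" | "n = 2" | k where "n = Suc (Suc (Suc k))"
      by (metis One_nat_def Suc_1 old.nat.exhaust)
    then show "coeff (\<phi> T_poly) n = coeff [:\<alpha>, u + \<alpha>, u:] n"
    proof cases
      case 1
      then show ?thesis
        by (simp add: coeff_\<phi> T0)
    next
      case 2
      then show ?thesis
        using c(2) by (simp add: coeff_\<phi> g_def mult.commute)
    next
      case 3
      then show ?thesis
        using c(3) by (simp add: coeff_\<phi> \<Delta>_def mult.commute numeral_2_eq_2)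
    next
      case 4
      then have "coeff (\<psi> T_poly) n = 0"
        using deg by (intro coeff_eq_0) simp
      then show ?thesis
        using 4 by (simp add: coeff_\<phi>)
    qed
  qed
  moreover have "drinfeld_module \<gamma> 2 \<phi>" "supersingular L \<phi>"
    unfolding \<phi>_def using drinfeld_conj[OF D c(1)] supersingular_conj[OF ss c(1)] by auto
  ultimately show ?thesis
    using that by blast
qed

lemma bij_betw_supersingular_X0T:
  "bij_betw (\<lambda>\<phi>. Affine (coeff (\<phi> T_poly) 2)) (supersingular_of_type L \<gamma>) (supersingular_X0T L \<gamma>)"
proof (rule bij_betwI')
  fix \<phi> \<psi>
  assume "\<phi> \<in> supersingular_of_type L \<gamma>" "\<psi> \<in> supersingular_of_type L \<gamma>"
  then show "Affine (coeff (\<phi> T_poly) 2) = Affine (coeff (\<psi> T_poly) 2) \<longleftrightarrow> \<phi> = \<psi>"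
    using inj_on_parameter by (auto dest: inj_onD)
next
  fix \<phi> assume "\<phi> \<in> supersingular_of_type L \<gamma>"
  then obtain u where u: "drinfeld_module \<gamma> 2 \<phi>" "supersingular L \<phi>" "u \<noteq> 0"
    "\<phi> T_poly = [:\<alpha>, u + \<alpha>, u:]" "coeff (\<phi> T_poly) 2 = u"
    by (rule supersingular_of_typeE)
  have "X0T_to_X1 CARD('f) \<alpha> (Affine u) = Affine (j_invariant \<phi>)"
    using u(3) by (simp add: j_invariant_def u(4) numeral_2_eq_2)
  then show "Affine (coeff (\<phi> T_poly) 2) \<in> supersingular_X0T L \<gamma>"
    unfolding u(5) supersingular_X0T_def supersingular_X1_def using u(1,2) by auto
next
  fix x assume x: "x \<in> supersingular_X0T L \<gamma>"
  then obtain \<psi> where \<psi>: "drinfeld_module \<gamma> 2 \<psi>" "supersingular L \<psi>"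
    and "X0T_to_X1 CARD('f) \<alpha> x = Affine (j_invariant \<psi>)"
    unfolding supersingular_X0T_def supersingular_X1_def by auto
  then obtain u where u: "x = Affine u" "u \<noteq> 0" "j_invariant \<psi> = (u + \<alpha>) ^ (q + 1) / u"
    by (cases x) (auto simp: q_eq split: if_splits)
  obtain \<phi> where \<phi>: "drinfeld_module \<gamma> 2 \<phi>" "supersingular L \<phi>" "\<phi> T_poly = [:\<alpha>, u + \<alpha>, u:]"
    using supersingular_same_j[OF \<psi> u(2,3)] by blast
  moreover have "x = Affine (coeff (\<phi> T_poly) 2)"
    by (simp add: u(1) \<phi>(3) numeral_2_eq_2)
  ultimately show "\<exists>\<phi>\<in>supersingular_of_type L \<gamma>. x = Affine (coeff (\<phi> T_poly) 2)"
    using supersingular_of_typeI[OF \<phi>(1,2) u(2) \<phi>(3)] by blast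
qed

text \<open>
  At \<open>s = 0\<close> the recursion becomes \<open>p\<^sub>i\<^sub>+\<^sub>1(0) = - p\<^sub>i(0)\<close>. Thus a root of \<open>p\<^sub>d\<close> corresponds to a
  nonzero parameter \<open>u\<close>.
\<close>

lemma p_red_0_nonzero:
  assumes "\<alpha> \<noteq> 0"
  shows "poly (p_red \<gamma> n) 0 \<noteq> 0"
proof (induction n)
  case 0
  then show ?case
    by (simp add: p_red_def p_poly_def poly_red_p_shift[OF assms])
next
  case (Suc n)
  then show ?case
    by (simp add: p_red_def p_poly_def poly_red_p_shift(3)[OF assms] del: p_shift.simps)
qed

lemma ex_supersingular_of_root:
  assumes \<alpha>: "\<alpha> \<noteq> 0" and root: "poly (p_red \<gamma> d) a = 0"
  obtains \<phi> where "\<phi> \<in> supersingular_of_type L \<gamma>" "a = - coeff (\<phi> T_poly) 2 / \<alpha> ^ q"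
proof -
  define u where "u = - a * \<alpha> ^ q"
  have a: "a = - u / \<alpha> ^ q"
    using \<alpha> by (simp add: u_def)
  have "a \<noteq> 0"
    using root p_red_0_nonzero[OF \<alpha>] by auto
  then have u: "u \<noteq> 0"
    using \<alpha> by (simp add: u_def)
  have "coeff [:\<alpha>, u + \<alpha>, u:] 0 = \<alpha>" "degree [:\<alpha>, u + \<alpha>, u:] = 2"
    using u by simp_all
  then obtain \<phi> where \<phi>: "drinfeld_module \<gamma> 2 \<phi>" "\<phi> T_poly = [:\<alpha>, u + \<alpha>, u:]"
    using drinfeld_module_exists[of "[:\<alpha>, u + \<alpha>, u:]" 2] by auto
  have "supersingular L \<phi>"
    using root unfolding a supersingular_iff_hasse[OF \<phi>(1)] hasse_iff_p_root[OF \<phi> \<alpha>] .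
  then have "\<phi> \<in> supersingular_of_type L \<gamma>"
    by (rule supersingular_of_typeI[OF \<phi>(1) _ u \<phi>(2)])
  moreover have "a = - coeff (\<phi> T_poly) 2 / \<alpha> ^ q"
    unfolding a \<phi>(2) by (simp add: numeral_2_eq_2)
  ultimately show ?thesis
    using that by blast
qed

lemma supersingular_root:
  assumes \<alpha>: "\<alpha> \<noteq> 0" and \<phi>: "\<phi> \<in> supersingular_of_type L \<gamma>"
  defines "a \<equiv> - coeff (\<phi> T_poly) 2 / \<alpha> ^ q"
  shows "poly (p_red \<gamma> d) a = 0" and "a ^ (q ^ (2 * d)) = a"
proof -
  obtain u where u: "drinfeld_module \<gamma> 2 \<phi>" "supersingular L \<phi>" "u \<noteq> 0"
    "\<phi> T_poly = [:\<alpha>, u + \<alpha>, u:]" "coeff (\<phi> T_poly) 2 = u"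
    using \<phi> by (rule supersingular_of_typeE)
  show "poly (p_red \<gamma> d) a = 0"
    using u(2) unfolding a_def u(5) supersingular_iff_hasse[OF u(1)] hasse_iff_p_root[OF u(1,4) \<alpha>] .
  have "q ^ (2 * d) = q ^ d * q ^ d"
    by (simp add: mult_2 power_add)
  then have "\<alpha> ^ (q ^ (2 * d)) = \<alpha>"
    by (simp add: power_mult \<alpha>_power_d)
  then have "(\<alpha> ^ q) ^ (q ^ (2 * d)) = \<alpha> ^ q"
    by (metis power_mult mult.commute)
  then show "a ^ (q ^ (2 * d)) = a"
    unfolding a_def u(5) power_divide frob_power_minus
    by (simp add: supersingular_parameter_power[OF u(1,2,4)])
qed

end

theorem theorem18:
  fixes L :: "'f::{finite,field} poly"
    and \<rho> :: "'f poly \<Rightarrow> 'l::field"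
    and \<gamma> :: "'f poly \<Rightarrow> 'l alg_closure"
    and \<alpha> :: "'l alg_closure"
    and E :: "'l alg_closure set"
    and d :: nat
  assumes "irreducible L" and "lead_coeff L = 1" and "L \<noteq> T_poly" and "degree L = d"
    and "residue_map L \<rho>"
    and "\<gamma> = (\<lambda>a. to_ac (\<rho> a))" and "\<alpha> = \<gamma> T_poly"
    and "quadratic_extension E"
  shows
    "bij_betw (\<lambda>\<phi>. Affine (coeff (\<phi> T_poly) 2))
       (supersingular_of_type L \<gamma>) (supersingular_X0T L \<gamma>)
     \<and> bij_betw (\<lambda>\<phi>. - coeff (\<phi> T_poly) 2 / \<alpha> ^ CARD('f))
         (supersingular_of_type L \<gamma>) {a \<in> E. poly (map_poly to_ac (p_red \<rho> d)) a = 0}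
     \<and> (\<forall>a. poly (map_poly to_ac (p_red \<rho> d)) a = 0 \<longrightarrow> a \<in> E)"
proof -
  interpret \<rho>: A_field \<rho> "CARD('f)"
    using assms(5) by unfold_locales (auto simp: residue_map_def)
  have ker: "\<rho> a = 0 \<longleftrightarrow> L dvd a" for a
    using assms(5) by (simp add: residue_map_def)
  interpret A_field_char \<gamma> "CARD('f)" L
    using assms(1) by unfold_locales (auto simp: assms(6) \<rho>.\<gamma>_1 \<rho>.\<gamma>_add \<rho>.\<gamma>_mult ker)
  have \<alpha>_nonzero: "\<gamma> T_poly \<noteq> 0"
  proof
    assume "\<gamma> T_poly = 0"
    then obtain M where M: "T_poly = L * M"
      by (auto simp: \<gamma>_eq_0_iff)
    then have "M \<noteq> 0"
      by auto
    then have "degree (L * M) = degree L + degree M"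
      using L_nonzero by (rule degree_mult_eq[rotated])
    then have "degree M = 0"
      using d_pos unfolding M[symmetric] by simp
    then obtain c where c: "M = [:c:]"
      by (rule degree_eq_zeroE)
    have "lead_coeff (L * M) = 1"
      unfolding M[symmetric] by simp
    then have "c = 1"
      unfolding lead_coeff_mult assms(2) by (simp add: c)
    then show False
      using M c assms(3) by simp
  qed
  have red: "map_poly to_ac (p_red \<rho> d) = p_red \<gamma> d"
  proof (rule poly_eqI)
    fix n
    have "coeff (p_poly d) n \<in> \<rho>.loc_ring"
      using \<rho>.loc_poly_p_shift[of "Suc d"] \<alpha>_nonzero
      by (auto simp: assms(6) \<rho>.loc_poly_def p_poly_def)
    then obtain a b where ab: "coeff (p_poly d) n = Fract a b" "\<rho> b \<noteq> 0"
      by (rule \<rho>.loc_ringE)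
    then have "\<gamma> b \<noteq> 0"
      by (simp add: assms(6))
    then show "coeff (map_poly to_ac (p_red \<rho> d)) n = coeff (p_red \<gamma> d) n"
      by (simp add: p_red_def coeff_map_poly ab \<rho>.fract_red_Fract fract_red_Fract) (simp add: assms(6))
  qed
  have range: "range \<gamma> = range (to_ac :: 'l \<Rightarrow> _)"
    using assms(5) by (auto simp: assms(6) residue_map_def surj_def) (metis rangeI)
  have "card (range \<gamma>) = CARD('l)"
    unfolding range by (intro card_image inj_to_ac)
  then have card: "CARD('l) = CARD('f) ^ d"
    by (simp add: card_residue_field assms(4))
  have "finite (UNIV :: 'l set)"
    using finite_residue_field unfolding range by (rule finite_imageD[OF _ inj_to_ac])
  then have E: "E = {x. x ^ (CARD('f) ^ (2 * d)) = x}"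
    using quadratic_extension_eq[OF assms(8)] by (simp add: card power_mult[symmetric] mult.commute)
  note root = supersingular_root[OF \<alpha>_nonzero, unfolded assms(4)]
    and root_ex = ex_supersingular_of_root[OF \<alpha>_nonzero, unfolded assms(4)]
  have "bij_betw (\<lambda>\<phi>. - coeff (\<phi> T_poly) 2 / \<alpha> ^ CARD('f))
      (supersingular_of_type L \<gamma>) {a \<in> E. poly (p_red \<gamma> d) a = 0}"
    unfolding assms(7)
  proof (rule bij_betwI')
    fix \<phi> \<psi>
    assume "\<phi> \<in> supersingular_of_type L \<gamma>" "\<psi> \<in> supersingular_of_type L \<gamma>"
    then show "- coeff (\<phi> T_poly) 2 / \<gamma> T_poly ^ CARD('f) = - coeff (\<psi> T_poly) 2 / \<gamma> T_poly ^ CARD('f)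
        \<longleftrightarrow> \<phi> = \<psi>"
      using inj_on_parameter \<alpha>_nonzero by (auto dest: inj_onD)
  next
    fix \<phi> assume "\<phi> \<in> supersingular_of_type L \<gamma>"
    then show "- coeff (\<phi> T_poly) 2 / \<gamma> T_poly ^ CARD('f) \<in> {a \<in> E. poly (p_red \<gamma> d) a = 0}"
      unfolding E by (intro CollectI conjI root)
  next
    fix a assume "a \<in> {a \<in> E. poly (p_red \<gamma> d) a = 0}"
    then have "poly (p_red \<gamma> d) a = 0"
      by simp
    then obtain \<phi> where "\<phi> \<in> supersingular_of_type L \<gamma>"
      "a = - coeff (\<phi> T_poly) 2 / \<gamma> T_poly ^ CARD('f)"
      by (rule root_ex)
    then show "\<exists>\<phi>\<in>supersingular_of_type L \<gamma>. a = - coeff (\<phi> T_poly) 2 / \<gamma> T_poly ^ CARD('f)"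
      by blast
  qed
  moreover have "a \<in> E" if "poly (p_red \<gamma> d) a = 0" for a
  proof -
    obtain \<phi> where "\<phi> \<in> supersingular_of_type L \<gamma>"
      and a: "a = - coeff (\<phi> T_poly) 2 / \<gamma> T_poly ^ CARD('f)"
      using \<open>poly (p_red \<gamma> d) a = 0\<close> by (rule root_ex)
    then show ?thesis
      unfolding a E by (intro CollectI root)
  qed
  ultimately show ?thesis
    using bij_betw_supersingular_X0T by (simp add: red)
qed

end
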